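(* Let $(\check M^{2n},\check g,J)$ be an almost Hermitian manifold and $f\colon\mathbb R\to\mathbb R$ a strictly positive smooth function, and equip the warped product $M=\mathbb R\times_f\check M$ with its induced almost contact metric structure. Suppose that $\check M$ is a cosymplectic almost Hermitian manifold, or $f$ is constant. Then the induced almost contact structure on $\mathbb R\times_f\check M$ is harmonic if and only if the almost Hermitian structure on $\check M$ is harmonic. In particular, if $\check M$ is a nearly Kähler manifold then the induced almost contact structure is harmonic.
   Context: An almost contact metric structure on a Riemannian manifold $(M^{2n+1},g)$ consists of a $(1,1)$-tensor $\phi$, a unit vector field $\xi$ and its dual $1$-form $\eta=g(\xi,\cdot)$, with $\phi^2=-I+\eta\otimes\xi$ and $g(\phi X,\phi Y)=g(X,Y)-\eta(X)\eta(Y)$. Everything is smooth. $\nabla$ is the Levi-Civita connection; $\mathcal{D}=\operatorname{im}\phi=\ker\eta$; $J=\phi|_{\mathcal D}$; $\bar\nabla$ is the connection in $\mathcal{D}\to M$ given by $\bar\nabla_XY=(\nabla_XY)_{\mathcal D}$ (orthogonal projection), $X\in TM$, $Y$ a section of $\mathcal D$. $\nabla^2_{X,Y}=\nabla_X\nabla_Y-\nabla_{\nabla_XY}$ and $\bar\nabla^2_{X,Y}=\bar\nabla_X\bar\nabla_Y-\bar\nabla_{\nabla_XY}$. For a local orthonormal frame $(E_i)$ of $TM$ (sums over repeated indices): $\nabla^*\nabla\xi=-\nabla^2_{E_i,E_i}\xi$, $\bar\nabla^*\bar\nabla J=-\bar\nabla^2_{E_i,E_i}J$, and $$\tau(\xi)=\nabla^*\nabla\xi-|\nabla\xi|^2\xi,\quad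 \tau(J)=[\bar\nabla^*\bar\nabla J,J],\quad T(\phi)=(\bar\nabla_{E_i}J)\big(\nabla_{E_i}\xi\big),$$ where $[\cdot,\cdot]$ is the commutator of endomorphisms of $\mathcal D$ (note that $\nabla_X\xi\in\mathcal D$). The almost contact metric structure is harmonic if it is given by a harmonic section of the associated bundle with fibre $SO(2n+1)/U(n)$; equivalently (known result, used here as the definition), if both $\tau(\xi)+\tfrac12 J\,T(\phi)=0$ and $\tau(J)=0$ hold. The warped product $\mathbb R\times_f\check M$ is $\mathbb R\times\check M$ with metric $g=dt^2+f(t)^2\check g$. Its induced almost contact metric structure is given by $\xi=\partial_t$, $\mathcal D=T\check M$ equipped with the almost complex structure $J$ of $\check M$ (so $\phi\xi=0$ and $\phi|_{\mathcal D}=J$). An almost Hermitian manifold $(\check M,\check g,J)$, with Levi-Civita connection $\check\nabla$, is: harmonic (i.e. its almost Hermitian structure is harmonic) if $[\check\nabla^*\check\nabla J,J]=0$, where $\check\nabla^*\check\nabla=-\operatorname{tr}\check\nabla^2$; cosymplectic if its Kähler form is co-closed (equivalently $\sum_i(\check\nabla_{F_i}J)(F_i)=0$ for local orthonormal frames $(F_i)$); nearly Kähler if $(\check\nabla_XJ)X=0$ for all $X$. *)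

theory Defs
  imports "HOL-Analysis.Analysis"
begin

section \<open>Smooth maps on open subsets of Euclidean spaces\<close>

primrec Ck_on :: "nat \<Rightarrow> 'a::euclidean_space set \<Rightarrow> ('a \<Rightarrow> 'b::real_normed_vector) \<Rightarrow> bool" where
  "Ck_on 0 S f \<longleftrightarrow> continuous_on S f"
| "Ck_on (Suc k) S f \<longleftrightarrow>
     (\<forall>x\<in>S. f differentiable (at x)) \<and> (\<forall>v. Ck_on k S (\<lambda>x. frechet_derivative f (at x) v))"

text \<open>Used for open \<open>S\<close> only.\<close>

definition smooth_on :: "'a::euclidean_space set \<Rightarrow> ('a \<Rightarrow> 'b::real_normed_vector) \<Rightarrow> bool" where
  "smooth_on S f \<longleftrightarrow> (\<forall>k. Ck_on k S f)"


section \<open>Smooth manifolds\<close>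

text \<open>
  A manifold with points in \<open>'a\<close> modelled on the Euclidean space \<open>'e\<close> is given by a topology and
  an atlas (not necessarily maximal) that is indexed by a subset of \<open>'i\<close>. The tangent bundle is
  trivial over each chart; a tensor field is given by its local representatives, one for each
  chart, which are functions on the image of the chart in \<open>'e\<close> and transform under changes of
  charts by the derivative of the transition map.
\<close>

record ('i, 'a, 'e) manifold =
  mtop :: "'a topology"
  charts :: "'i set"
  cdom :: "'i \<Rightarrow> 'a set"
  cmap :: "'i \<Rightarrow> 'a \<Rightarrow> 'e"

definition cimg :: "('i, 'a, 'e, 'z) manifold_scheme \<Rightarrow> 'i \<Rightarrow> 'e set" where
  "cimg M i = cmap M i ` cdom M i"

definition transition :: "('i, 'a, 'e, 'z) manifold_scheme \<Rightarrow> 'i \<Rightarrow> 'i \<Rightarrow> 'e \<Rightarrow> 'e" where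
  "transition M i j x = cmap M j (inv_into (cdom M i) (cmap M i) x)"

definition smooth_manifold :: "('i, 'a, 'e::euclidean_space, 'z) manifold_scheme \<Rightarrow> bool" where
  "smooth_manifold M \<longleftrightarrow>
     Hausdorff_space (mtop M) \<and> second_countable (mtop M) \<and>
     (\<Union>i\<in>charts M. cdom M i) = topspace (mtop M) \<and>
     (\<forall>i\<in>charts M. openin (mtop M) (cdom M i) \<and> open (cimg M i) \<and>
        homeomorphic_map (subtopology (mtop M) (cdom M i)) (top_of_set (cimg M i)) (cmap M i)) \<and>
     (\<forall>i\<in>charts M. \<forall>j\<in>charts M.
        smooth_on (cmap M i ` (cdom M i \<inter> cdom M j)) (transition M i j))"

definition transition_deriv :: "('i, 'a, 'e::euclidean_space, 'z) manifold_scheme \<Rightarrow> 'i \<Rightarrow> 'i \<Rightarrow> 'a \<Rightarrow> 'e \<Rightarrow> 'e" where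
  "transition_deriv M i j p = frechet_derivative (transition M i j) (at (cmap M i p))"

definition smooth_vector_field ::
    "('i, 'a, 'e::euclidean_space, 'z) manifold_scheme \<Rightarrow> ('i \<Rightarrow> 'e \<Rightarrow> 'e) \<Rightarrow> bool" where
  "smooth_vector_field M X \<longleftrightarrow>
     (\<forall>i\<in>charts M. smooth_on (cimg M i) (X i)) \<and>
     (\<forall>i\<in>charts M. \<forall>j\<in>charts M. \<forall>p\<in>cdom M i \<inter> cdom M j.
        X j (cmap M j p) = transition_deriv M i j p (X i (cmap M i p)))"

definition smooth_endomorphism_field ::
    "('i, 'a, 'e::euclidean_space, 'z) manifold_scheme \<Rightarrow> ('i \<Rightarrow> 'e \<Rightarrow> 'e \<Rightarrow> 'e) \<Rightarrow> bool" where
  "smooth_endomorphism_field M A \<longleftrightarrow>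
     (\<forall>i\<in>charts M. (\<forall>x\<in>cimg M i. linear (A i x)) \<and> (\<forall>v. smooth_on (cimg M i) (\<lambda>x. A i x v))) \<and>
     (\<forall>i\<in>charts M. \<forall>j\<in>charts M. \<forall>p\<in>cdom M i \<inter> cdom M j. \<forall>v.
        A j (cmap M j p) (transition_deriv M i j p v) = transition_deriv M i j p (A i (cmap M i p) v))"

definition riemannian_metric ::
    "('i, 'a, 'e::euclidean_space, 'z) manifold_scheme \<Rightarrow> ('i \<Rightarrow> 'e \<Rightarrow> 'e \<Rightarrow> 'e \<Rightarrow> real) \<Rightarrow> bool" where
  "riemannian_metric M g \<longleftrightarrow>
     (\<forall>i\<in>charts M. (\<forall>x\<in>cimg M i. bilinear (g i x) \<and> (\<forall>u v. g i x u v = g i x v u) \<and>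
                       (\<forall>v. v \<noteq> 0 \<longrightarrow> g i x v v > 0)) \<and>
        (\<forall>u v. smooth_on (cimg M i) (\<lambda>x. g i x u v))) \<and>
     (\<forall>i\<in>charts M. \<forall>j\<in>charts M. \<forall>p\<in>cdom M i \<inter> cdom M j. \<forall>u v.
        g j (cmap M j p) (transition_deriv M i j p u) (transition_deriv M i j p v)
          = g i (cmap M i p) u v)"


section \<open>The Levi-Civita connection in a chart\<close>

text \<open>
  On an open set \<open>V\<close> of \<open>'e\<close>, every linear connection on the tangent bundle is of the form
  \<open>\<nabla>\<^sub>X Y = dY(X) + \<Gamma>(X, Y)\<close> with a bilinear \<open>\<Gamma>\<close>.
\<close>

definition nabla :: "('e \<Rightarrow> 'e \<Rightarrow> 'e \<Rightarrow> 'e) \<Rightarrow> ('e \<Rightarrow> 'e) \<Rightarrow> ('e \<Rightarrow> 'e) \<Rightarrow> 'e \<Rightarrow> 'e::euclidean_space" where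
  "nabla \<Gamma> X Y x = frechet_derivative Y (at x) (X x) + \<Gamma> x (X x) (Y x)"

definition lie_bracket :: "('e \<Rightarrow> 'e) \<Rightarrow> ('e \<Rightarrow> 'e) \<Rightarrow> 'e \<Rightarrow> 'e::euclidean_space" where
  "lie_bracket X Y x = frechet_derivative Y (at x) (X x) - frechet_derivative X (at x) (Y x)"

definition is_levi_civita ::
    "'e::euclidean_space set \<Rightarrow> ('e \<Rightarrow> 'e \<Rightarrow> 'e \<Rightarrow> real) \<Rightarrow> ('e \<Rightarrow> 'e \<Rightarrow> 'e \<Rightarrow> 'e) \<Rightarrow> bool" where
  "is_levi_civita V g \<Gamma> \<longleftrightarrow>
     (\<forall>x\<in>V. bilinear (\<Gamma> x)) \<and> (\<forall>u v. smooth_on V (\<lambda>x. \<Gamma> x u v)) \<and>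
     (\<forall>X Y. smooth_on V X \<longrightarrow> smooth_on V Y \<longrightarrow>
        (\<forall>x\<in>V. nabla \<Gamma> X Y x - nabla \<Gamma> Y X x = lie_bracket X Y x)) \<and>
     (\<forall>X Y Z. smooth_on V X \<longrightarrow> smooth_on V Y \<longrightarrow> smooth_on V Z \<longrightarrow>
        (\<forall>x\<in>V. frechet_derivative (\<lambda>y. g y (Y y) (Z y)) (at x) (X x)
                 = g x (nabla \<Gamma> X Y x) (Z x) + g x (Y x) (nabla \<Gamma> X Z x)))"

text \<open>For a Riemannian metric such a \<open>\<Gamma>\<close> exists and its values on \<open>V\<close> are unique.\<close>

definition levi_civita ::
    "'e::euclidean_space set \<Rightarrow> ('e \<Rightarrow> 'e \<Rightarrow> 'e \<Rightarrow> real) \<Rightarrow> 'e \<Rightarrow> 'e \<Rightarrow> 'e \<Rightarrow> 'e" where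
  "levi_civita V g = (SOME \<Gamma>. is_levi_civita V g \<Gamma>)"

definition nabla2 ::
    "('e \<Rightarrow> 'e \<Rightarrow> 'e \<Rightarrow> 'e) \<Rightarrow> ('e \<Rightarrow> 'e) \<Rightarrow> ('e \<Rightarrow> 'e) \<Rightarrow> ('e \<Rightarrow> 'e) \<Rightarrow> 'e \<Rightarrow> 'e::euclidean_space" where
  "nabla2 \<Gamma> X Y Z x = nabla \<Gamma> X (nabla \<Gamma> Y Z) x - nabla \<Gamma> (nabla \<Gamma> X Y) Z x"

text \<open>
  Derivatives of a field \<open>A\<close> of endomorphisms, by \<open>(\<nabla>\<^sub>X A) Z = \<nabla>\<^sub>X (A Z) - A (\<nabla>\<^sub>X Z)\<close>; a tangent
  vector \<open>z\<close> at \<open>x\<close> is extended to the vector field that is constant in the chart.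
\<close>

definition nabla_end ::
    "('e \<Rightarrow> 'e \<Rightarrow> 'e \<Rightarrow> 'e) \<Rightarrow> ('e \<Rightarrow> 'e) \<Rightarrow> ('e \<Rightarrow> 'e \<Rightarrow> 'e) \<Rightarrow> 'e \<Rightarrow> 'e \<Rightarrow> 'e::euclidean_space" where
  "nabla_end \<Gamma> X A x z = nabla \<Gamma> X (\<lambda>y. A y z) x - A x (nabla \<Gamma> X (\<lambda>_. z) x)"

definition nabla2_end ::
    "('e \<Rightarrow> 'e \<Rightarrow> 'e \<Rightarrow> 'e) \<Rightarrow> ('e \<Rightarrow> 'e) \<Rightarrow> ('e \<Rightarrow> 'e) \<Rightarrow> ('e \<Rightarrow> 'e \<Rightarrow> 'e) \<Rightarrow> 'e \<Rightarrow> 'e \<Rightarrow> 'e::euclidean_space" where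
  "nabla2_end \<Gamma> X Y A x z =
     nabla_end \<Gamma> X (nabla_end \<Gamma> Y A) x z - nabla_end \<Gamma> (nabla \<Gamma> X Y) A x z"

definition orthonormal_basis :: "('e \<Rightarrow> 'e \<Rightarrow> real) \<Rightarrow> 'e::euclidean_space set \<Rightarrow> bool" where
  "orthonormal_basis h B \<longleftrightarrow>
     card B = DIM('e) \<and> (\<forall>u\<in>B. \<forall>v\<in>B. h u v = (if u = v then 1 else 0))"

text \<open>
  Sums over a local orthonormal frame at a point: the summands \<open>T u v\<close> below are bilinear in the
  values of the frame at the point, so that any orthonormal basis of the tangent space gives the
  same sum; its elements are extended to constant vector fields where a derivative requires this.
\<close>

definition metric_trace ::
    "('e::euclidean_space \<Rightarrow> 'e \<Rightarrow> real) \<Rightarrow> ('e \<Rightarrow> 'e \<Rightarrow> 'b) \<Rightarrow> 'b::comm_monoid_add" where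
  "metric_trace h T = (\<Sum>e\<in>(SOME B. orthonormal_basis h B). T e e)"


section \<open>Almost Hermitian manifolds\<close>

record ('i, 'a, 'e) riemannian_manifold = "('i, 'a, 'e) manifold" +
  rmetric :: "'i \<Rightarrow> 'e \<Rightarrow> 'e \<Rightarrow> 'e \<Rightarrow> real"

definition lc :: "('i, 'a, 'e::euclidean_space, 'z) riemannian_manifold_scheme \<Rightarrow> 'i \<Rightarrow> 'e \<Rightarrow> 'e \<Rightarrow> 'e \<Rightarrow> 'e" where
  "lc M i = levi_civita (cimg M i) (rmetric M i)"

record ('i, 'a, 'e) almost_hermitian = "('i, 'a, 'e) riemannian_manifold" +
  cstr :: "'i \<Rightarrow> 'e \<Rightarrow> 'e \<Rightarrow> 'e"

definition almost_hermitian_manifold ::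
    "('i, 'a, 'e::euclidean_space) almost_hermitian \<Rightarrow> bool" where
  "almost_hermitian_manifold M \<longleftrightarrow>
     smooth_manifold M \<and> riemannian_metric M (rmetric M) \<and> smooth_endomorphism_field M (cstr M) \<and>
     (\<forall>i\<in>charts M. \<forall>x\<in>cimg M i.
        (\<forall>v. cstr M i x (cstr M i x v) = - v) \<and>
        (\<forall>u v. rmetric M i x (cstr M i x u) (cstr M i x v) = rmetric M i x u v))"

definition rough_laplacian_cstr ::
    "('i, 'a, 'e::euclidean_space) almost_hermitian \<Rightarrow> 'i \<Rightarrow> 'e \<Rightarrow> 'e \<Rightarrow> 'e" where
  "rough_laplacian_cstr M i x z =
     - metric_trace (rmetric M i x) (\<lambda>u v. nabla2_end (lc M i) (\<lambda>_. u) (\<lambda>_. v) (cstr M i) x z)"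

definition harmonic_almost_hermitian ::
    "('i, 'a, 'e::euclidean_space) almost_hermitian \<Rightarrow> bool" where
  "harmonic_almost_hermitian M \<longleftrightarrow>
     (\<forall>i\<in>charts M. \<forall>x\<in>cimg M i. \<forall>z.
        rough_laplacian_cstr M i x (cstr M i x z) - cstr M i x (rough_laplacian_cstr M i x z) = 0)"

definition kaehler_form ::
    "('i, 'a, 'e::euclidean_space) almost_hermitian \<Rightarrow> 'i \<Rightarrow> 'e \<Rightarrow> 'e \<Rightarrow> 'e \<Rightarrow> real" where
  "kaehler_form M i x u v = rmetric M i x (cstr M i x u) v"

definition nabla_form ::
    "('e \<Rightarrow> 'e \<Rightarrow> 'e \<Rightarrow> 'e) \<Rightarrow> ('e \<Rightarrow> 'e) \<Rightarrow> ('e \<Rightarrow> 'e \<Rightarrow> 'e \<Rightarrow> real) \<Rightarrow> 'e \<Rightarrow> 'e \<Rightarrow> 'e::euclidean_space \<Rightarrow> real" where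
  "nabla_form \<Gamma> X \<omega> x u v =
     frechet_derivative (\<lambda>y. \<omega> y u v) (at x) (X x)
       - \<omega> x (nabla \<Gamma> X (\<lambda>_. u) x) v - \<omega> x u (nabla \<Gamma> X (\<lambda>_. v) x)"

definition codifferential_kaehler_form ::
    "('i, 'a, 'e::euclidean_space) almost_hermitian \<Rightarrow> 'i \<Rightarrow> 'e \<Rightarrow> 'e \<Rightarrow> real" where
  "codifferential_kaehler_form M i x w =
     - metric_trace (rmetric M i x) (\<lambda>u v. nabla_form (lc M i) (\<lambda>_. u) (kaehler_form M i) x v w)"

definition cosymplectic :: "('i, 'a, 'e::euclidean_space) almost_hermitian \<Rightarrow> bool" where
  "cosymplectic M \<longleftrightarrow>
     (\<forall>i\<in>charts M. \<forall>x\<in>cimg M i. \<forall>w. codifferential_kaehler_form M i x w = 0)"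

definition nearly_kaehler :: "('i, 'a, 'e::euclidean_space) almost_hermitian \<Rightarrow> bool" where
  "nearly_kaehler M \<longleftrightarrow>
     (\<forall>i\<in>charts M. \<forall>x\<in>cimg M i. \<forall>v. nabla_end (lc M i) (\<lambda>_. v) (cstr M i) x v = 0)"


section \<open>Almost contact metric manifolds\<close>

record ('i, 'a, 'e) almost_contact = "('i, 'a, 'e) riemannian_manifold" +
  phi :: "'i \<Rightarrow> 'e \<Rightarrow> 'e \<Rightarrow> 'e"
  xi :: "'i \<Rightarrow> 'e \<Rightarrow> 'e"

definition eta :: "('i, 'a, 'e::euclidean_space) almost_contact \<Rightarrow> 'i \<Rightarrow> 'e \<Rightarrow> 'e \<Rightarrow> real" where
  "eta M i x v = rmetric M i x (xi M i x) v"

definition almost_contact_metric_manifold ::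
    "('i, 'a, 'e::euclidean_space) almost_contact \<Rightarrow> bool" where
  "almost_contact_metric_manifold M \<longleftrightarrow>
     smooth_manifold M \<and> riemannian_metric M (rmetric M) \<and>
     smooth_endomorphism_field M (phi M) \<and> smooth_vector_field M (xi M) \<and>
     (\<forall>i\<in>charts M. \<forall>x\<in>cimg M i.
        rmetric M i x (xi M i x) (xi M i x) = 1 \<and>
        (\<forall>v. phi M i x (phi M i x v) = - v + eta M i x v *\<^sub>R xi M i x) \<and>
        (\<forall>u v. rmetric M i x (phi M i x u) (phi M i x v)
                 = rmetric M i x u v - eta M i x u * eta M i x v))"

text \<open>Orthogonal projection of the tangent bundle to \<open>\<D> = ker \<eta>\<close>.\<close>

definition projD :: "('i, 'a, 'e::euclidean_space) almost_contact \<Rightarrow> 'i \<Rightarrow> 'e \<Rightarrow> 'e \<Rightarrow> 'e" where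
  "projD M i x v = v - eta M i x v *\<^sub>R xi M i x"

definition nablaD ::
    "('i, 'a, 'e::euclidean_space) almost_contact \<Rightarrow> 'i \<Rightarrow> ('e \<Rightarrow> 'e) \<Rightarrow> ('e \<Rightarrow> 'e) \<Rightarrow> 'e \<Rightarrow> 'e" where
  "nablaD M i X Y x = projD M i x (nabla (lc M i) X Y x)"

text \<open>
  A field \<open>A\<close> of endomorphisms of \<open>\<D>\<close> is represented by a field of endomorphisms of the tangent
  bundle of which only the values on \<open>\<D>\<close> matter. A vector \<open>z\<close> in the fibre of \<open>\<D>\<close> at \<open>x\<close> is
  extended to the section \<open>\<lambda>y. projD M i y z\<close> of \<open>\<D>\<close>.
\<close>

definition nablaD_end ::
    "('i, 'a, 'e::euclidean_space) almost_contact \<Rightarrow> 'i \<Rightarrow> ('e \<Rightarrow> 'e) \<Rightarrow> ('e \<Rightarrow> 'e \<Rightarrow> 'e) \<Rightarrow> 'e \<Rightarrow> 'e \<Rightarrow> 'e" where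
  "nablaD_end M i X A x z =
     nablaD M i X (\<lambda>y. A y (projD M i y z)) x - A x (nablaD M i X (\<lambda>y. projD M i y z) x)"

definition nablaD2_end ::
    "('i, 'a, 'e::euclidean_space) almost_contact \<Rightarrow> 'i \<Rightarrow> ('e \<Rightarrow> 'e) \<Rightarrow> ('e \<Rightarrow> 'e) \<Rightarrow> ('e \<Rightarrow> 'e \<Rightarrow> 'e) \<Rightarrow> 'e \<Rightarrow> 'e \<Rightarrow> 'e" where
  "nablaD2_end M i X Y A x z =
     nablaD_end M i X (nablaD_end M i Y A) x z - nablaD_end M i (nabla (lc M i) X Y) A x z"

definition rough_laplacian_xi ::
    "('i, 'a, 'e::euclidean_space) almost_contact \<Rightarrow> 'i \<Rightarrow> 'e \<Rightarrow> 'e" where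
  "rough_laplacian_xi M i x =
     - metric_trace (rmetric M i x) (\<lambda>u v. nabla2 (lc M i) (\<lambda>_. u) (\<lambda>_. v) (xi M i) x)"

definition norm2_nabla_xi ::
    "('i, 'a, 'e::euclidean_space) almost_contact \<Rightarrow> 'i \<Rightarrow> 'e \<Rightarrow> real" where
  "norm2_nabla_xi M i x =
     metric_trace (rmetric M i x)
       (\<lambda>u v. rmetric M i x (nabla (lc M i) (\<lambda>_. u) (xi M i) x) (nabla (lc M i) (\<lambda>_. v) (xi M i) x))"

definition rough_laplacian_J ::
    "('i, 'a, 'e::euclidean_space) almost_contact \<Rightarrow> 'i \<Rightarrow> 'e \<Rightarrow> 'e \<Rightarrow> 'e" where
  "rough_laplacian_J M i x z =
     - metric_trace (rmetric M i x) (\<lambda>u v. nablaD2_end M i (\<lambda>_. u) (\<lambda>_. v) (phi M i) x z)"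

definition tau_xi :: "('i, 'a, 'e::euclidean_space) almost_contact \<Rightarrow> 'i \<Rightarrow> 'e \<Rightarrow> 'e" where
  "tau_xi M i x = rough_laplacian_xi M i x - norm2_nabla_xi M i x *\<^sub>R xi M i x"

definition tau_J :: "('i, 'a, 'e::euclidean_space) almost_contact \<Rightarrow> 'i \<Rightarrow> 'e \<Rightarrow> 'e \<Rightarrow> 'e" where
  "tau_J M i x z = rough_laplacian_J M i x (phi M i x z) - phi M i x (rough_laplacian_J M i x z)"

definition T_phi :: "('i, 'a, 'e::euclidean_space) almost_contact \<Rightarrow> 'i \<Rightarrow> 'e \<Rightarrow> 'e" where
  "T_phi M i x =
     metric_trace (rmetric M i x)
       (\<lambda>u v. nablaD_end M i (\<lambda>_. u) (phi M i) x (nabla (lc M i) (\<lambda>_. v) (xi M i) x))"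

definition harmonic_almost_contact ::
    "('i, 'a, 'e::euclidean_space) almost_contact \<Rightarrow> bool" where
  "harmonic_almost_contact M \<longleftrightarrow>
     (\<forall>i\<in>charts M. \<forall>x\<in>cimg M i.
        tau_xi M i x + (1/2) *\<^sub>R phi M i x (T_phi M i x) = 0 \<and>
        (\<forall>z. eta M i x z = 0 \<longrightarrow> tau_J M i x z = 0))"


section \<open>Warped products\<close>

definition warped_product ::
    "(real \<Rightarrow> real) \<Rightarrow> ('i, 'a, 'e::euclidean_space) almost_hermitian
       \<Rightarrow> ('i, real \<times> 'a, real \<times> 'e) almost_contact" where
  "warped_product f M =
     \<lparr>mtop = prod_topology euclideanreal (mtop M),
      charts = charts M,
      cdom = (\<lambda>i. UNIV \<times> cdom M i),
      cmap = (\<lambda>i (t, p). (t, cmap M i p)),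
      rmetric = (\<lambda>i (t, x) (a, u) (b, v). a * b + (f t)\<^sup>2 * rmetric M i x u v),
      phi = (\<lambda>i (t, x) (a, u). (0, cstr M i x u)),
      xi = (\<lambda>i x. (1, 0))\<rparr>"

section \<open>The induced structure on a warped product\<close>

lemma Ck_on_Suc_D:
  assumes "Ck_on (Suc k) S f" "x \<in> S"
  shows "(f has_derivative frechet_derivative f (at x)) (at x)"
proof -
  have "f differentiable (at x)" using assms by simp
  then show ?thesis by (rule iffD1[OF frechet_derivative_works])
qed

lemma Ck_on_Suc_D2: "Ck_on (Suc k) S f \<Longrightarrow> Ck_on k S (\<lambda>x. frechet_derivative f (at x) v)"
  by simp

lemma Ck_on_cong:
  assumes "open S" "\<And>x. x \<in> S \<Longrightarrow> f x = g x" "Ck_on k S f"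
  shows "Ck_on k S g"
  using assms(2,3)
proof (induction k arbitrary: f g)
  case 0
  then show ?case by (simp cong: continuous_on_cong)
next
  case (Suc k)
  have d: "(g has_derivative frechet_derivative f (at x)) (at x)" if "x \<in> S" for x
    by (rule has_derivative_transform_within_open[OF Ck_on_Suc_D[OF Suc.prems(2) that] assms(1) that Suc.prems(1)])
  have e: "frechet_derivative f (at x) = frechet_derivative g (at x)" if "x \<in> S" for x
    using d[OF that] by (rule frechet_derivative_at)
  have "Ck_on k S (\<lambda>x. frechet_derivative g (at x) v)" for v
    by (rule Suc.IH[OF _ Ck_on_Suc_D2[OF Suc.prems(2), of v]]) (simp add: e)
  then show ?case
    using d unfolding Ck_on.simps differentiable_def by blast
qed

lemma Ck_on_SucI:
  assumes "open S" "\<And>x. x \<in> S \<Longrightarrow> (f has_derivative f' x) (at x)" "\<And>v. Ck_on k S (\<lambda>x. f' x v)"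
  shows "Ck_on (Suc k) S f"
proof -
  have e: "f' x = frechet_derivative f (at x)" if "x \<in> S" for x
    using assms(2)[OF that] by (rule frechet_derivative_at)
  have "Ck_on k S (\<lambda>x. frechet_derivative f (at x) v)" for v
    by (rule Ck_on_cong[OF assms(1) _ assms(3)]) (simp add: e)
  then show ?thesis
    using assms(2) unfolding Ck_on.simps differentiable_def by blast
qed

lemma Ck_on_Suc_imp:
  assumes "open S" "Ck_on (Suc k) S f"
  shows "Ck_on k S f"
  using assms(2)
proof (induction k arbitrary: f)
  case 0
  have "isCont f x" if "x \<in> S" for x
    using Ck_on_Suc_D[OF 0 that] by (rule has_derivative_continuous)
  then show ?case by (simp add: continuous_at_imp_continuous_on)
next
  case (Suc k)
  have "Ck_on k S (\<lambda>x. frechet_derivative f (at x) v)" for v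
    by (rule Suc.IH) (use Suc.prems in simp)
  then show ?case
    using Suc.prems by simp
qed

lemma Ck_on_const: "open S \<Longrightarrow> Ck_on k S (\<lambda>_. c)"
proof (induction k arbitrary: c)
  case (Suc k)
  show ?case
    by (rule Ck_on_SucI[where f' = "\<lambda>_ _. 0"]) (use Suc in auto)
qed simp

lemma Ck_on_add: "open S \<Longrightarrow> Ck_on k S f \<Longrightarrow> Ck_on k S g \<Longrightarrow> Ck_on k S (\<lambda>x. f x + g x)"
proof (induction k arbitrary: f g)
  case 0 then show ?case by (auto intro: continuous_intros)
next
  case (Suc k)
  show ?case
  proof (rule Ck_on_SucI[where f' = "\<lambda>x v. frechet_derivative f (at x) v + frechet_derivative g (at x) v"])
    show "open S" by (fact Suc.prems(1))
  next
    fix x assume "x \<in> S"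
    then show "((\<lambda>x. f x + g x) has_derivative (\<lambda>v. frechet_derivative f (at x) v + frechet_derivative g (at x) v)) (at x)"
      by (intro has_derivative_add Ck_on_Suc_D[OF Suc.prems(2)] Ck_on_Suc_D[OF Suc.prems(3)])
  next
    fix v
    show "Ck_on k S (\<lambda>x. frechet_derivative f (at x) v + frechet_derivative g (at x) v)"
      by (rule Suc.IH[OF Suc.prems(1) Ck_on_Suc_D2[OF Suc.prems(2)] Ck_on_Suc_D2[OF Suc.prems(3)]])
  qed
qed

lemma Ck_on_mult:
  fixes f g :: "'a::euclidean_space \<Rightarrow> real"
  shows "open S \<Longrightarrow> Ck_on k S f \<Longrightarrow> Ck_on k S g \<Longrightarrow> Ck_on k S (\<lambda>x. f x * g x)"
proof (induction k arbitrary: f g)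
  case 0 then show ?case by (auto intro: continuous_intros)
next
  case (Suc k)
  show ?case
  proof (rule Ck_on_SucI[where f' = "\<lambda>x v. f x * frechet_derivative g (at x) v + frechet_derivative f (at x) v * g x"])
    show "((\<lambda>x. f x * g x) has_derivative (\<lambda>v. f x * frechet_derivative g (at x) v + frechet_derivative f (at x) v * g x)) (at x)"
      if "x \<in> S" for x
      using has_derivative_mult[OF Ck_on_Suc_D[OF Suc.prems(2) that] Ck_on_Suc_D[OF Suc.prems(3) that]] .
    show "Ck_on k S (\<lambda>x. f x * frechet_derivative g (at x) v + frechet_derivative f (at x) v * g x)" for v
      by (intro Ck_on_add Suc.IH Suc.prems(1) Ck_on_Suc_imp[OF _ Suc.prems(2)] Ck_on_Suc_imp[OF _ Suc.prems(3)])
        (use Suc.prems in auto)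
  qed (fact Suc.prems(1))
qed

lemma Ck_on_Pair: "open S \<Longrightarrow> Ck_on k S f \<Longrightarrow> Ck_on k S g \<Longrightarrow> Ck_on k S (\<lambda>x. (f x, g x))"
proof (induction k arbitrary: f g)
  case 0 then show ?case by (auto intro: continuous_intros)
next
  case (Suc k)
  show ?case
  proof (rule Ck_on_SucI[where f' = "\<lambda>x v. (frechet_derivative f (at x) v, frechet_derivative g (at x) v)"])
    show "open S" by (fact Suc.prems(1))
  next
    fix x assume "x \<in> S"
    then show "((\<lambda>x. (f x, g x)) has_derivative (\<lambda>v. (frechet_derivative f (at x) v, frechet_derivative g (at x) v))) (at x)"
      by (intro has_derivative_Pair Ck_on_Suc_D[OF Suc.prems(2)] Ck_on_Suc_D[OF Suc.prems(3)])
  next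
    fix v
    show "Ck_on k S (\<lambda>x. (frechet_derivative f (at x) v, frechet_derivative g (at x) v))"
      by (rule Suc.IH[OF Suc.prems(1) Ck_on_Suc_D2[OF Suc.prems(2)] Ck_on_Suc_D2[OF Suc.prems(3)]])
  qed
qed

lemma Ck_on_linear_comp:
  assumes "bounded_linear p" "open S" "open R" "p ` R \<subseteq> S"
  shows "Ck_on k S f \<Longrightarrow> Ck_on k R (\<lambda>x. f (p x))"
proof (induction k arbitrary: f)
  case 0
  then show ?case
    using assms continuous_on_compose2[OF _ linear_continuous_on[OF assms(1)]] by auto
next
  case (Suc k)
  show ?case
  proof (rule Ck_on_SucI[where f' = "\<lambda>x v. frechet_derivative f (at (p x)) (p v)"])
    show "((\<lambda>x. f (p x)) has_derivative (\<lambda>v. frechet_derivative f (at (p x)) (p v))) (at x)"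
      if "x \<in> R" for x
    proof -
      have "p x \<in> S" using that assms by auto
      from has_derivative_compose[OF bounded_linear_imp_has_derivative[OF assms(1)] Ck_on_Suc_D[OF Suc.prems this]]
      show ?thesis .
    qed
    show "Ck_on k R (\<lambda>x. frechet_derivative f (at (p x)) (p v))" for v
      by (rule Suc.IH[of "\<lambda>x. frechet_derivative f (at x) (p v)"]) (rule Ck_on_Suc_D2[OF Suc.prems])
  qed (fact assms(3))
qed

lemma second_countable_prod_topology:
  assumes "second_countable X" "second_countable Y"
  shows "second_countable (prod_topology X Y)"
proof -
  obtain A where A: "countable A" "\<And>V. V \<in> A \<Longrightarrow> openin X V"
    "\<forall>U x. openin X U \<and> x \<in> U \<longrightarrow> (\<exists>V \<in> A. x \<in> V \<and> V \<subseteq> U)"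
    using assms(1) by (auto simp: second_countable_def)
  obtain B where B: "countable B" "\<And>V. V \<in> B \<Longrightarrow> openin Y V"
    "\<forall>U x. openin Y U \<and> x \<in> U \<longrightarrow> (\<exists>V \<in> B. x \<in> V \<and> V \<subseteq> U)"
    using assms(2) by (auto simp: second_countable_def)
  show ?thesis
    unfolding second_countable_def
  proof (intro exI conjI allI impI)
    show "countable ((\<lambda>(U, V). U \<times> V) ` (A \<times> B))"
      using A(1) B(1) by blast
    show "\<forall>V\<in>(\<lambda>(U, V). U \<times> V) ` (A \<times> B). openin (prod_topology X Y) V"
      using A(2) B(2) by (auto simp: openin_prod_Times_iff)
  next
    fix W and z :: "'a \<times> 'b"
    assume W: "openin (prod_topology X Y) W \<and> z \<in> W"
    obtain x y where z: "z = (x, y)" by fastforce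
    have "\<exists>U V. openin X U \<and> openin Y V \<and> x \<in> U \<and> y \<in> V \<and> U \<times> V \<subseteq> W"
      using W[THEN conjunct1] W[THEN conjunct2] unfolding z openin_prod_topology_alt by blast
    then obtain U V where UV: "openin X U" "openin Y V" "x \<in> U" "y \<in> V" "U \<times> V \<subseteq> W"
      by blast
    obtain U' where U': "U' \<in> A" "x \<in> U'" "U' \<subseteq> U" using A(3) UV(1,3) by meson
    obtain V' where V': "V' \<in> B" "y \<in> V'" "V' \<subseteq> V" using B(3) UV(2,4) by meson
    from U' V' have "U' \<times> V' \<in> (\<lambda>(U, V). U \<times> V) ` (A \<times> B)" "z \<in> U' \<times> V'" "U' \<times> V' \<subseteq> W"
      using UV(5) unfolding z by fast+
    then show "\<exists>V\<in>(\<lambda>(U, V). U \<times> V) ` (A \<times> B). z \<in> V \<and> V \<subseteq> W" by blast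
  qed
qed

lemma second_countable_euclideanreal: "second_countable euclideanreal"
proof -
  obtain B :: "real set set" where B: "countable B" "\<And>C. C \<in> B \<Longrightarrow> open C"
    "\<And>S. open S \<Longrightarrow> \<exists>U. U \<subseteq> B \<and> S = \<Union>U"
    by (rule univ_second_countable) blast
  have "\<exists>V\<in>B. x \<in> V \<and> V \<subseteq> S" if S: "open S" "x \<in> S" for S x
  proof -
    obtain U where "U \<subseteq> B" "S = \<Union>U" using B(3)[OF S(1)] by blast
    then show ?thesis using S(2) by blast
  qed
  then show ?thesis
    unfolding second_countable_def using B(1,2) by (intro exI[of _ B]) simp
qed

lemma smooth_manifold_chartD:
  assumes "smooth_manifold M" "i \<in> charts M"
  shows "openin (mtop M) (cdom M i)" "open (cimg M i)"
    "homeomorphic_map (subtopology (mtop M) (cdom M i)) (top_of_set (cimg M i)) (cmap M i)"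
    "inj_on (cmap M i) (cdom M i)"
proof -
  show 1: "openin (mtop M) (cdom M i)" and "open (cimg M i)"
    and h: "homeomorphic_map (subtopology (mtop M) (cdom M i)) (top_of_set (cimg M i)) (cmap M i)"
    using assms by (auto simp: smooth_manifold_def)
  have "topspace (subtopology (mtop M) (cdom M i)) = cdom M i"
    using openin_subset[OF 1] by auto
  then show "inj_on (cmap M i) (cdom M i)"
    using h by (metis homeomorphic_imp_injective_map)
qed

lemma open_chart_overlap:
  assumes "smooth_manifold M" "i \<in> charts M" "j \<in> charts M"
  shows "open (cmap M i ` (cdom M i \<inter> cdom M j))"
proof -
  note i = smooth_manifold_chartD[OF assms(1,2)]
  have "openin (subtopology (mtop M) (cdom M i)) (cdom M i \<inter> cdom M j)"
    using smooth_manifold_chartD(1)[OF assms(1,3)] openin_subtopology_Int2 by blast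
  then have "openin (top_of_set (cimg M i)) (cmap M i ` (cdom M i \<inter> cdom M j))"
    using i(3) homeomorphic_imp_open_map open_map_def by blast
  then show ?thesis
    using i(2) openin_open_trans by blast
qed

lemma smooth_on_differentiable:
  "smooth_on S f \<Longrightarrow> x \<in> S \<Longrightarrow> (f has_derivative frechet_derivative f (at x)) (at x)"
  using Ck_on_Suc_D[of 0 S f x] by (simp only: smooth_on_def)

lemma smooth_on_const: "open S \<Longrightarrow> smooth_on S (\<lambda>_. c)"
  by (simp add: smooth_on_def Ck_on_const)

lemma smooth_on_cong: "open S \<Longrightarrow> (\<And>x. x \<in> S \<Longrightarrow> f x = g x) \<Longrightarrow> smooth_on S f \<Longrightarrow> smooth_on S g"
  using Ck_on_cong unfolding smooth_on_def by blast

lemma smooth_on_fst: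
  assumes "smooth_on UNIV f" "open S"
  shows "smooth_on (UNIV \<times> S) (\<lambda>x. f (fst x))"
  unfolding smooth_on_def
proof
  fix k
  show "Ck_on k (UNIV \<times> S) (\<lambda>x. f (fst x))"
    by (rule Ck_on_linear_comp[OF bounded_linear_fst, of UNIV])
      (use assms in \<open>auto simp: smooth_on_def open_Times\<close>)
qed

lemma smooth_on_snd:
  assumes "smooth_on S f" "open S"
  shows "smooth_on (UNIV \<times> S) (\<lambda>x. f (snd x))"
  unfolding smooth_on_def
proof
  fix k
  show "Ck_on k (UNIV \<times> S) (\<lambda>x. f (snd x))"
    by (rule Ck_on_linear_comp[OF bounded_linear_snd, of S])
      (use assms in \<open>auto simp: smooth_on_def open_Times\<close>)
qed

lemma smooth_on_id: "open S \<Longrightarrow> smooth_on S (\<lambda>x. x)"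
proof -
  assume S: "open S"
  have "Ck_on k S (\<lambda>x. x)" for k
  proof (cases k)
    case (Suc m)
    show ?thesis unfolding Suc
      by (rule Ck_on_SucI[where f' = "\<lambda>_ v. v"]) (auto simp: S Ck_on_const)
  qed simp
  then show ?thesis by (simp add: smooth_on_def)
qed

lemma warped_product_simps [simp]:
  "mtop (warped_product f M) = prod_topology euclideanreal (mtop M)"
  "charts (warped_product f M) = charts M"
  "cdom (warped_product f M) i = UNIV \<times> cdom M i"
  "cmap (warped_product f M) i (t, p) = (t, cmap M i p)"
  "rmetric (warped_product f M) i (t, x) (a, u) (b, v) = a * b + (f t)\<^sup>2 * rmetric M i x u v"
  "phi (warped_product f M) i (t, x) (a, u) = (0, cstr M i x u)"
  "xi (warped_product f M) i y = (1, 0)"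
  by (simp_all add: warped_product_def)

lemma cmap_warped_product: "cmap (warped_product f M) i = (\<lambda>(t, p). (t, cmap M i p))"
  by (auto simp: fun_eq_iff)

lemma cimg_warped_product [simp]: "cimg (warped_product f M) i = UNIV \<times> cimg M i"
  by (force simp: cimg_def)

lemma transition_warped_product:
  assumes "smooth_manifold M" "i \<in> charts M" "x \<in> cimg M i"
  shows "transition (warped_product f M) i j (t, x) = (t, transition M i j x)"
proof -
  note inj = smooth_manifold_chartD(4)[OF assms(1,2)]
  obtain p where p: "p \<in> cdom M i" "x = cmap M i p" using assms(3) by (auto simp: cimg_def)
  have "inj_on (cmap (warped_product f M) i) (UNIV \<times> cdom M i)"
    using inj by (auto simp: inj_on_def)
  then have "inv_into (UNIV \<times> cdom M i) (cmap (warped_product f M) i) (t, x) = (t, p)"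
    using p by (intro inv_into_f_eq) auto
  moreover have "inv_into (cdom M i) (cmap M i) x = p"
    using p inj by (simp add: inv_into_f_f)
  ultimately show ?thesis by (simp add: transition_def)
qed

lemma overlap_warped_product:
  "cmap (warped_product f M) i ` (cdom (warped_product f M) i \<inter> cdom (warped_product f M) j)
     = UNIV \<times> cmap M i ` (cdom M i \<inter> cdom M j)"
  by force

lemma transition_deriv_warped_product:
  assumes "smooth_manifold M" "i \<in> charts M" "j \<in> charts M" "p \<in> cdom M i \<inter> cdom M j"
  shows "transition_deriv (warped_product f M) i j (t, p) (a, u) = (a, transition_deriv M i j p u)"
proof -
  let ?O = "cmap M i ` (cdom M i \<inter> cdom M j)"
  note o = open_chart_overlap[OF assms(1-3)]
  have d: "(transition M i j has_derivative transition_deriv M i j p) (at (cmap M i p))"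
    unfolding transition_deriv_def
    by (rule smooth_on_differentiable[of ?O]) (use assms in \<open>auto simp: smooth_manifold_def\<close>)
  have "((\<lambda>y. transition M i j (snd y)) has_derivative (\<lambda>v. transition_deriv M i j p (snd v))) (at (t, cmap M i p))"
    by (rule has_derivative_compose[of snd snd "(t, cmap M i p)"]) (use d in \<open>auto intro: has_derivative_snd\<close>)
  then have "((\<lambda>y. (fst y, transition M i j (snd y))) has_derivative
      (\<lambda>v. (fst v, transition_deriv M i j p (snd v)))) (at (t, cmap M i p))"
    by (intro has_derivative_Pair has_derivative_fst has_derivative_ident)
  then have "(transition (warped_product f M) i j has_derivative
      (\<lambda>v. (fst v, transition_deriv M i j p (snd v)))) (at (t, cmap M i p))"
    by (rule has_derivative_transform_within_open[where s = "UNIV \<times> ?O"])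
      (use assms(4) o in \<open>auto simp: open_Times transition_warped_product[OF assms(1,2)] cimg_def\<close>)
  then show ?thesis
    by (simp add: transition_deriv_def frechet_derivative_at[symmetric])
qed

lemma smooth_manifold_warped_product:
  assumes M: "smooth_manifold M"
  shows "smooth_manifold (warped_product f M)"
  unfolding smooth_manifold_def
proof (intro conjI ballI)
  show "Hausdorff_space (mtop (warped_product f M))"
    using M by (simp add: smooth_manifold_def Hausdorff_space_prod_topology)
  show "second_countable (mtop (warped_product f M))"
    using M by (simp add: smooth_manifold_def second_countable_prod_topology second_countable_euclideanreal)
  show "(\<Union>i\<in>charts (warped_product f M). cdom (warped_product f M) i) = topspace (mtop (warped_product f M))"
    using M by (auto simp: smooth_manifold_def)
next
  fix i assume "i \<in> charts (warped_product f M)"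
  then have i: "i \<in> charts M" by simp
  note ci = smooth_manifold_chartD[OF M i]
  show "openin (mtop (warped_product f M)) (cdom (warped_product f M) i)"
    using ci(1) by (simp add: openin_prod_Times_iff)
  show "open (cimg (warped_product f M) i)"
    using ci(2) by (simp add: open_Times)
  obtain g where g: "homeomorphic_maps (subtopology (mtop M) (cdom M i)) (top_of_set (cimg M i)) (cmap M i) g"
    using ci(3) by (auto simp: homeomorphic_map_maps)
  have "homeomorphic_maps (prod_topology euclideanreal (subtopology (mtop M) (cdom M i)))
      (prod_topology euclideanreal (top_of_set (cimg M i)))
      (\<lambda>(t, p). (id t, cmap M i p)) (\<lambda>(t, x). (id t, g x))"
    using g by (simp add: homeomorphic_maps_prod homeomorphic_maps_id del: id_apply)
  then show "homeomorphic_map (subtopology (mtop (warped_product f M)) (cdom (warped_product f M) i))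
          (top_of_set (cimg (warped_product f M) i)) (cmap (warped_product f M) i)"
    unfolding homeomorphic_map_maps cmap_warped_product
    using prod_topology_subtopology_eu[of "UNIV :: real set" "cimg M i"]
    by (simp add: subtopology_Times subtopology_UNIV) blast
next
  fix i j assume "i \<in> charts (warped_product f M)" "j \<in> charts (warped_product f M)"
  then have ij: "i \<in> charts M" "j \<in> charts M" by simp_all
  let ?O = "cmap M i ` (cdom M i \<inter> cdom M j)"
  note o = open_chart_overlap[OF M ij]
  have "smooth_on ?O (transition M i j)" using M ij by (auto simp: smooth_manifold_def)
  then have "smooth_on ((UNIV :: real set) \<times> ?O) (\<lambda>y. transition M i j (snd y))"
    using o by (rule smooth_on_snd)
  moreover have "smooth_on ((UNIV :: real set) \<times> ?O) fst"
    by (rule smooth_on_fst[OF smooth_on_id[OF open_UNIV] o])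
  moreover have "open ((UNIV :: real set) \<times> ?O)"
    using o by (simp add: open_Times)
  ultimately have "smooth_on ((UNIV :: real set) \<times> ?O) (\<lambda>y. (fst y, transition M i j (snd y)))"
    unfolding smooth_on_def by (intro allI Ck_on_Pair) auto
  then show "smooth_on (cmap (warped_product f M) i ` (cdom (warped_product f M) i \<inter> cdom (warped_product f M) j))
      (transition (warped_product f M) i j)"
    unfolding overlap_warped_product
    by (rule smooth_on_cong[rotated 2])
      (use o in \<open>auto simp: open_Times transition_warped_product[OF M ij(1)] cimg_def\<close>)
qed

lemma bilinear_warped_product:
  assumes "bilinear (rmetric M i x)"
  shows "bilinear (rmetric (warped_product f M) i (t, x))"
proof -
  note b = bilinear_ladd[OF assms] bilinear_radd[OF assms] bilinear_lmul[OF assms] bilinear_rmul[OF assms]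
  show ?thesis
    unfolding bilinear_def
    by (intro conjI allI linearI) (auto simp: b algebra_simps)
qed

lemma riemannian_metric_warped_product:
  fixes M :: "('i, 'a, 'c::euclidean_space) almost_hermitian"
  assumes M: "smooth_manifold M" and g: "riemannian_metric M (rmetric M)"
    and f: "smooth_on UNIV f" "\<forall>t. f t > 0"
  shows "riemannian_metric (warped_product f M) (rmetric (warped_product f M))"
  unfolding riemannian_metric_def
proof (intro conjI ballI allI)
  fix i y assume "i \<in> charts (warped_product f M)" and y: "y \<in> cimg (warped_product f M) i"
  then have i: "i \<in> charts M" by simp
  obtain t x where yx: "y = (t, x)" "x \<in> cimg M i" using y by auto
  have gx: "bilinear (rmetric M i x)" "\<And>u v. rmetric M i x u v = rmetric M i x v u"
    "\<And>v. v \<noteq> 0 \<Longrightarrow> rmetric M i x v v > 0"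
    using g i yx(2) by (auto simp: riemannian_metric_def)
  show "bilinear (rmetric (warped_product f M) i y)"
    by (simp add: yx bilinear_warped_product gx)
  show "rmetric (warped_product f M) i y u v = rmetric (warped_product f M) i y v u" for u v
    using gx(2) by (cases u; cases v) (simp add: yx)
  show "v \<noteq> 0 \<longrightarrow> 0 < rmetric (warped_product f M) i y v v" for v
  proof
    assume v: "v \<noteq> 0"
    obtain a u where av: "v = (a, u)" by fastforce
    show "0 < rmetric (warped_product f M) i y v v"
    proof (cases "u = 0")
      case True
      then have "a * a > 0" using v av by (metis zero_prod_def mult_eq_0_iff not_real_square_gt_zero)
      then show ?thesis using True bilinear_lzero[OF gx(1)] by (simp add: yx av)
    next
      case False
      have "f t \<noteq> 0" using f(2) by (metis less_irrefl)
      then have "0 < (f t)\<^sup>2 * rmetric M i x u u" using gx(3)[OF False] by simp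
      then show ?thesis by (simp add: yx av add_nonneg_pos)
    qed
  qed
next
  fix i and v w :: "real \<times> 'c" assume "i \<in> charts (warped_product f M)"
  then have i: "i \<in> charts M" by simp
  note o = smooth_manifold_chartD(2)[OF M i]
  obtain a u b u' where vw: "v = (a, u)" "w = (b, u')" by fastforce
  have s: "smooth_on (cimg M i) (\<lambda>x. rmetric M i x u u')" using g i by (auto simp: riemannian_metric_def)
  have op: "open (UNIV \<times> cimg M i :: (real \<times> _) set)"
    using o by (simp add: open_Times)
  have "smooth_on ((UNIV :: real set) \<times> cimg M i) (\<lambda>y. a * b + (f (fst y) * f (fst y)) * rmetric M i (snd y) u u')"
    using smooth_on_fst[OF f(1) o] smooth_on_snd[OF s o]
    unfolding smooth_on_def by (intro allI Ck_on_add[OF op] Ck_on_mult[OF op] Ck_on_const[OF op]) auto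
  then show "smooth_on (cimg (warped_product f M) i) (\<lambda>x. rmetric (warped_product f M) i x v w)"
    unfolding cimg_warped_product
    by (rule smooth_on_cong[rotated 2]) (use o in \<open>auto simp: open_Times vw power2_eq_square\<close>)
next
  fix i j q and v w :: "real \<times> 'c"
  assume "i \<in> charts (warped_product f M)" "j \<in> charts (warped_product f M)"
    and q: "q \<in> cdom (warped_product f M) i \<inter> cdom (warped_product f M) j"
  then have ij: "i \<in> charts M" "j \<in> charts M" by simp_all
  obtain t p where tp: "q = (t, p)" "p \<in> cdom M i \<inter> cdom M j" using q by auto
  obtain a u b u' where vw: "v = (a, u)" "w = (b, u')" by fastforce
  show "rmetric (warped_product f M) j (cmap (warped_product f M) j q)
        (transition_deriv (warped_product f M) i j q v) (transition_deriv (warped_product f M) i j q w)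
      = rmetric (warped_product f M) i (cmap (warped_product f M) i q) v w"
    using g ij tp(2)
    by (simp add: tp(1) vw transition_deriv_warped_product[OF M ij tp(2)] riemannian_metric_def)
qed

lemma smooth_phi_warped_product:
  fixes M :: "('i, 'a, 'c::euclidean_space) almost_hermitian"
  assumes M: "smooth_manifold M" and J: "smooth_endomorphism_field M (cstr M)"
  shows "smooth_endomorphism_field (warped_product f M) (phi (warped_product f M))"
  unfolding smooth_endomorphism_field_def
proof (intro conjI ballI allI)
  fix i y assume "i \<in> charts (warped_product f M)" and y: "y \<in> cimg (warped_product f M) i"
  then have i: "i \<in> charts M" by simp
  obtain t x where yx: "y = (t, x)" "x \<in> cimg M i" using y by auto
  have "linear (cstr M i x)" using J i yx(2) by (auto simp: smooth_endomorphism_field_def)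
  then show "linear (phi (warped_product f M) i y)"
    by (intro linearI) (auto simp: yx linear_add linear_scale)
next
  fix i and v :: "real \<times> 'c" assume "i \<in> charts (warped_product f M)"
  then have i: "i \<in> charts M" by simp
  note o = smooth_manifold_chartD(2)[OF M i]
  obtain a u where v: "v = (a, u)" by fastforce
  have s: "smooth_on (cimg M i) (\<lambda>x. cstr M i x u)" using J i by (auto simp: smooth_endomorphism_field_def)
  have op: "open (UNIV \<times> cimg M i :: (real \<times> _) set)"
    using o by (simp add: open_Times)
  have "smooth_on ((UNIV :: real set) \<times> cimg M i) (\<lambda>y. (0 :: real, cstr M i (snd y) u))"
    using smooth_on_snd[OF s o]
    unfolding smooth_on_def by (intro allI Ck_on_Pair[OF op] Ck_on_const[OF op]) auto
  then show "smooth_on (cimg (warped_product f M) i) (\<lambda>x. phi (warped_product f M) i x v)"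
    unfolding cimg_warped_product
    by (rule smooth_on_cong[rotated 2]) (use o in \<open>auto simp: open_Times v\<close>)
next
  fix i j q and v :: "real \<times> 'c"
  assume "i \<in> charts (warped_product f M)" "j \<in> charts (warped_product f M)"
    and q: "q \<in> cdom (warped_product f M) i \<inter> cdom (warped_product f M) j"
  then have ij: "i \<in> charts M" "j \<in> charts M" by simp_all
  obtain t p where tp: "q = (t, p)" "p \<in> cdom M i \<inter> cdom M j" using q by auto
  obtain a u where v: "v = (a, u)" by fastforce
  show "phi (warped_product f M) j (cmap (warped_product f M) j q) (transition_deriv (warped_product f M) i j q v)
      = transition_deriv (warped_product f M) i j q (phi (warped_product f M) i (cmap (warped_product f M) i q) v)"
    using J ij tp(2)
    by (simp add: tp(1) v transition_deriv_warped_product[OF M ij tp(2)] smooth_endomorphism_field_def)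
qed

lemma transition_deriv_zero:
  assumes "smooth_manifold M" "i \<in> charts M" "j \<in> charts M" "p \<in> cdom M i \<inter> cdom M j"
  shows "transition_deriv M i j p 0 = 0"
proof -
  have "(transition M i j has_derivative transition_deriv M i j p) (at (cmap M i p))"
    unfolding transition_deriv_def
    by (rule smooth_on_differentiable[of "cmap M i ` (cdom M i \<inter> cdom M j)"])
      (use assms in \<open>auto simp: smooth_manifold_def\<close>)
  then show ?thesis by (meson has_derivative_linear linear_0)
qed

theorem almost_contact_metric_manifold_warped_product:
  fixes M :: "('i, 'a, 'c::euclidean_space) almost_hermitian"
  assumes M: "almost_hermitian_manifold M" and f: "smooth_on UNIV f" "\<forall>t. f t > 0"
  shows "almost_contact_metric_manifold (warped_product f M)"
proof -
  have sm: "smooth_manifold M" and g: "riemannian_metric M (rmetric M)"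
    and J: "smooth_endomorphism_field M (cstr M)"
    and JJ: "\<And>i x v. i \<in> charts M \<Longrightarrow> x \<in> cimg M i \<Longrightarrow> cstr M i x (cstr M i x v) = - v"
    and gJ: "\<And>i x u v. i \<in> charts M \<Longrightarrow> x \<in> cimg M i \<Longrightarrow>
        rmetric M i x (cstr M i x u) (cstr M i x v) = rmetric M i x u v"
    using M by (auto simp: almost_hermitian_manifold_def)
  have xi: "smooth_vector_field (warped_product f M) (xi (warped_product f M))"
    unfolding smooth_vector_field_def
  proof (intro conjI ballI)
    fix i assume "i \<in> charts (warped_product f M)"
    then have "open (UNIV \<times> cimg M i :: (real \<times> _) set)"
      using smooth_manifold_chartD(2)[OF sm] by (simp add: open_Times)
    then have "smooth_on ((UNIV :: real set) \<times> cimg M i) (\<lambda>_. (1, 0) :: real \<times> 'c)"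
      by (rule smooth_on_const)
    moreover have "xi (warped_product f M) i = (\<lambda>_. (1, 0))"
      by (simp add: fun_eq_iff)
    ultimately show "smooth_on (cimg (warped_product f M) i) (xi (warped_product f M) i)"
      by simp
  next
    fix i j q
    assume "i \<in> charts (warped_product f M)" "j \<in> charts (warped_product f M)"
      and q: "q \<in> cdom (warped_product f M) i \<inter> cdom (warped_product f M) j"
    then have ij: "i \<in> charts M" "j \<in> charts M" by simp_all
    obtain t p where tp: "q = (t, p)" "p \<in> cdom M i \<inter> cdom M j" using q by auto
    show "xi (warped_product f M) j (cmap (warped_product f M) j q)
        = transition_deriv (warped_product f M) i j q
            (xi (warped_product f M) i (cmap (warped_product f M) i q))"
      by (simp add: tp(1) transition_deriv_warped_product[OF sm ij tp(2)]
          transition_deriv_zero[OF sm ij tp(2)])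
  qed
  have g0: "rmetric M i x 0 v = 0" if "i \<in> charts M" "x \<in> cimg M i" for i x v
    using g that bilinear_lzero by (metis riemannian_metric_def)
  show ?thesis
    unfolding almost_contact_metric_manifold_def
  proof (intro conjI ballI allI)
    fix i y and v w :: "real \<times> 'c"
    assume "i \<in> charts (warped_product f M)" and y: "y \<in> cimg (warped_product f M) i"
    then have i: "i \<in> charts M" by simp
    obtain t x where yx: "y = (t, x)" "x \<in> cimg M i" using y by auto
    obtain a u where v: "v = (a, u)" by fastforce
    obtain b u' where w: "w = (b, u')" by fastforce
    note simps = yx(1) v w eta_def JJ[OF i yx(2)] gJ[OF i yx(2)] g0[OF i yx(2)]
    show "rmetric (warped_product f M) i y (xi (warped_product f M) i y) (xi (warped_product f M) i y) = 1"
      by (simp add: simps)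
    show "phi (warped_product f M) i y (phi (warped_product f M) i y v)
        = - v + eta (warped_product f M) i y v *\<^sub>R xi (warped_product f M) i y"
      by (simp add: simps)
    show "rmetric (warped_product f M) i y (phi (warped_product f M) i y v) (phi (warped_product f M) i y w)
        = rmetric (warped_product f M) i y v w
          - eta (warped_product f M) i y v * eta (warped_product f M) i y w"
      by (simp add: simps)
  qed (use smooth_manifold_warped_product[OF sm] riemannian_metric_warped_product[OF sm g f]
      smooth_phi_warped_product[OF sm J] xi in blast)+
qed

end

theory Submission
  imports Defs
begin

text \<open>
  With \<open>q = f' / f\<close> the Levi-Civita connection of the warped product is
  \<open>\<nabla>\<^sub>U V = \<nabla>'\<^sub>U V - f f' h(U, V) \<partial>\<^sub>t\<close>, \<open>\<nabla>\<^sub>U \<partial>\<^sub>t = \<nabla>\<^sub>t U = q U\<close>, \<open>\<nabla>\<^sub>t \<partial>\<^sub>t = 0\<close> for vector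
  fields on the fibre, where \<open>\<nabla>'\<close> and \<open>h\<close> belong to the fibre. Hence
  \<open>\<nabla>\<^sup>*\<nabla>\<xi> = |\<nabla>\<xi>|\<^sup>2 \<xi> = 2 n q\<^sup>2 \<xi>\<close>, so that \<open>\<tau>(\<xi>) = 0\<close>; the tensor \<open>T(\<phi>)\<close> is \<open>q / f\<^sup>2\<close> times the
  divergence of \<open>J\<close>, and \<open>\<tau>(J)\<close> is \<open>1 / f\<^sup>2\<close> times its counterpart on the fibre.

  A nearly Kaehler structure is harmonic for the following reason. The trilinear form
  \<open>\<Psi>(X, Y, Z) = h((\<nabla>\<^sub>X J) Y, Z)\<close> is alternating and one third of the differential of the Kaehler
  form, hence closed. Let \<open>Q = \<Sum> \<nabla>\<^sup>2 J(F, F)\<close> and \<open>S = \<Sum> (\<nabla>\<^sub>F J)\<^sup>2\<close>, with sums over an orthonormal frame.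
  Summing \<open>d\<Psi>(F, J F, Y, Z) = 0\<close> gives \<open>Q J = - S\<close>, while \<open>J\<^sup>2 = - 1\<close> gives
  \<open>Q J + J Q = - 2 S\<close>; therefore \<open>Q J = J Q\<close>.
\<close>

section \<open>Smooth maps\<close>

text \<open>The product rule writes the derivative as a sum of two terms of the same shape
  \<open>p (f x) (g x)\<close>, so induction on the order closes. Scalar multiples, products and
  inner products are all instances.\<close>

lemma Ck_on_bilinear:
  fixes f :: "'a::euclidean_space \<Rightarrow> 'b::real_normed_vector"
    and g :: "'a \<Rightarrow> 'c::real_normed_vector"
    and p :: "'b \<Rightarrow> 'c \<Rightarrow> 'd::real_normed_vector"
  assumes "bounded_bilinear p" "open S"
  shows "Ck_on k S f \<Longrightarrow> Ck_on k S g \<Longrightarrow> Ck_on k S (\<lambda>x. p (f x) (g x))"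
proof (induction k arbitrary: f g)
  case 0
  then show ?case using bounded_bilinear.continuous_on[OF assms(1)] by simp
next
  case (Suc k)
  show ?case
  proof (rule Ck_on_SucI[where f' = "\<lambda>x v. p (f x) (frechet_derivative g (at x) v) + p (frechet_derivative f (at x) v) (g x)"])
    show "((\<lambda>x. p (f x) (g x)) has_derivative
        (\<lambda>v. p (f x) (frechet_derivative g (at x) v) + p (frechet_derivative f (at x) v) (g x))) (at x)"
      if "x \<in> S" for x
      by (rule bounded_bilinear.FDERIV[OF assms(1) Ck_on_Suc_D[OF Suc.prems(1) that]
            Ck_on_Suc_D[OF Suc.prems(2) that]])
    show "Ck_on k S (\<lambda>x. p (f x) (frechet_derivative g (at x) v) + p (frechet_derivative f (at x) v) (g x))" for v
      by (intro Ck_on_add Suc.IH Ck_on_Suc_D2 Suc.prems assms(2) Ck_on_Suc_imp[OF _ Suc.prems(1)]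
          Ck_on_Suc_imp[OF _ Suc.prems(2)])
  qed (fact assms(2))
qed

lemma smooth_on_bilinear:
  "bounded_bilinear p \<Longrightarrow> open S \<Longrightarrow> smooth_on S f \<Longrightarrow> smooth_on S g \<Longrightarrow> smooth_on S (\<lambda>x. p (f x) (g x))"
  unfolding smooth_on_def using Ck_on_bilinear by blast

lemmas smooth_on_scaleR = smooth_on_bilinear[OF bounded_bilinear_scaleR]
  and smooth_on_mult = smooth_on_bilinear[OF bounded_bilinear_mult]
  and smooth_on_inner = smooth_on_bilinear[OF bounded_bilinear_inner]

lemma smooth_on_add:
  "open S \<Longrightarrow> smooth_on S f \<Longrightarrow> smooth_on S g \<Longrightarrow> smooth_on S (\<lambda>x. f x + g x)"
  unfolding smooth_on_def using Ck_on_add by blast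

lemma smooth_on_uminus: "open S \<Longrightarrow> smooth_on S f \<Longrightarrow> smooth_on S (\<lambda>x. - f x)"
  using smooth_on_scaleR[of S "\<lambda>_. -1" f] by (simp add: smooth_on_const)

lemma smooth_on_diff:
  "open S \<Longrightarrow> smooth_on S f \<Longrightarrow> smooth_on S g \<Longrightarrow> smooth_on S (\<lambda>x. f x - g x)"
  using smooth_on_add[of S f "\<lambda>x. - g x"] by (simp add: smooth_on_uminus)

lemma smooth_on_sum:
  "open S \<Longrightarrow> (\<And>i. i \<in> I \<Longrightarrow> smooth_on S (f i)) \<Longrightarrow> smooth_on S (\<lambda>x. \<Sum>i\<in>I. f i x)"
  by (induction I rule: infinite_finite_induct) (auto intro: smooth_on_add smooth_on_const)

lemma smooth_on_Pair:
  "open S \<Longrightarrow> smooth_on S f \<Longrightarrow> smooth_on S g \<Longrightarrow> smooth_on S (\<lambda>x. (f x, g x))"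
  unfolding smooth_on_def using Ck_on_Pair by blast

lemma smooth_on_frechet_derivative:
  "smooth_on S f \<Longrightarrow> smooth_on S (\<lambda>x. frechet_derivative f (at x) v)"
  unfolding smooth_on_def using Ck_on_Suc_D2 by blast

lemma smooth_on_imp_differentiable: "smooth_on S f \<Longrightarrow> x \<in> S \<Longrightarrow> f differentiable (at x)"
  by (rule differentiableI[OF smooth_on_differentiable])

lemma smooth_on_imp_continuous_on: "smooth_on S f \<Longrightarrow> continuous_on S f"
  unfolding smooth_on_def by (metis Ck_on.simps(1))

text \<open>The derivative of the reciprocal is a product of the reciprocal itself, twice, with the
  derivative of \<open>f\<close>; the induction hypothesis covers the first and the assumption on
  \<open>f\<close> the second.\<close>

lemma Ck_on_inverse:
  fixes f :: "'a::euclidean_space \<Rightarrow> real"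
  assumes "open S" "\<And>x. x \<in> S \<Longrightarrow> f x \<noteq> 0"
  shows "Ck_on k S f \<Longrightarrow> Ck_on k S (\<lambda>x. inverse (f x))"
proof (induction k)
  case 0
  then show ?case using assms(2) by (auto intro: continuous_intros)
next
  case (Suc k)
  have f: "Ck_on k S f"
    by (rule Ck_on_Suc_imp[OF assms(1) Suc.prems])
  show ?case
  proof (rule Ck_on_SucI[where f' = "\<lambda>x v. - (inverse (f x) * frechet_derivative f (at x) v * inverse (f x))"])
    show "((\<lambda>x. inverse (f x)) has_derivative
        (\<lambda>v. - (inverse (f x) * frechet_derivative f (at x) v * inverse (f x)))) (at x)"
      if "x \<in> S" for x
      by (rule Deriv.has_derivative_inverse[OF assms(2)[OF that] Ck_on_Suc_D[OF Suc.prems that]])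
    have "Ck_on k S (\<lambda>x. (-1) * (inverse (f x) * frechet_derivative f (at x) v * inverse (f x)))" for v
      by (intro Ck_on_mult Ck_on_const assms(1) Suc.IH f Ck_on_Suc_D2 Suc.prems)
    then show "Ck_on k S (\<lambda>x. - (inverse (f x) * frechet_derivative f (at x) v * inverse (f x)))" for v
      by simp
  qed (fact assms(1))
qed

lemma smooth_on_divide:
  fixes f g :: "'a::euclidean_space \<Rightarrow> real"
  assumes "open S" "smooth_on S f" "smooth_on S g" "\<And>x. x \<in> S \<Longrightarrow> g x \<noteq> 0"
  shows "smooth_on S (\<lambda>x. f x / g x)"
proof -
  have "smooth_on S (\<lambda>x. inverse (g x))"
    using assms Ck_on_inverse unfolding smooth_on_def by blast
  then show ?thesis
    using smooth_on_mult[OF assms(1,2)] by (simp add: divide_inverse)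
qed

section \<open>Fields of linear and bilinear maps applied to varying arguments\<close>

lemma linear_basis_expansion:
  fixes A :: "'a::euclidean_space \<Rightarrow> 'b::real_vector"
  assumes "linear A"
  shows "A v = (\<Sum>b\<in>Basis. (v \<bullet> b) *\<^sub>R A b)"
proof -
  have "A v = A (\<Sum>b\<in>Basis. (v \<bullet> b) *\<^sub>R b)" by (simp add: euclidean_representation)
  then show ?thesis by (simp add: linear_sum[OF assms] linear_scale[OF assms])
qed

text \<open>Tensor fields are known to be smooth only on constant arguments. Expanding the argument
  in \<open>Basis\<close> reduces a varying argument to finitely many constant ones.\<close>

lemma smooth_on_linear_apply:
  fixes A :: "'a::euclidean_space \<Rightarrow> 'c::euclidean_space \<Rightarrow> 'd::real_normed_vector"
  assumes "open S" "\<And>x. x \<in> S \<Longrightarrow> linear (A x)" "\<And>v. smooth_on S (\<lambda>x. A x v)" "smooth_on S X"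
  shows "smooth_on S (\<lambda>x. A x (X x))"
proof -
  have "smooth_on S (\<lambda>x. \<Sum>b\<in>Basis. (X x \<bullet> b) *\<^sub>R A x b)"
    by (intro smooth_on_sum smooth_on_scaleR smooth_on_inner smooth_on_const assms)
  then show ?thesis
    by (rule smooth_on_cong[OF assms(1), rotated]) (rule linear_basis_expansion[OF assms(2), symmetric])
qed

lemma bilinear_imp_linear:
  assumes "bilinear B"
  shows "linear (B u)" "linear (\<lambda>u. B u v)"
  using assms by (auto simp: bilinear_def)

lemma smooth_on_bilinear_apply:
  fixes B :: "'a::euclidean_space \<Rightarrow> 'c::euclidean_space \<Rightarrow> 'c \<Rightarrow> 'd::real_normed_vector"
  assumes "open S" "\<And>x. x \<in> S \<Longrightarrow> bilinear (B x)" "\<And>u v. smooth_on S (\<lambda>x. B x u v)"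
    "smooth_on S X" "smooth_on S Y"
  shows "smooth_on S (\<lambda>x. B x (X x) (Y x))"
proof (rule smooth_on_linear_apply[of S "\<lambda>x u. B x u (Y x)" X, OF assms(1) _ _ assms(4)])
  show "linear (\<lambda>u. B x u (Y x))" if "x \<in> S" for x
    by (rule bilinear_imp_linear(2)[OF assms(2)[OF that]])
  show "smooth_on S (\<lambda>x. B x v (Y x))" for v
  proof (rule smooth_on_linear_apply[of S "\<lambda>x. B x v" Y, OF assms(1) _ assms(3) assms(5)])
    show "linear (B x v)" if "x \<in> S" for x
      by (rule bilinear_imp_linear(1)[OF assms(2)[OF that]])
  qed
qed

lemma frechet_derivative_eqI: "(f has_derivative f') (at x) \<Longrightarrow> frechet_derivative f (at x) = f'"
  by (rule frechet_derivative_at[symmetric])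

text \<open>\<open>frechet_derivative\<close> chooses from the set of all derivatives at the point,
  and this set is the same for functions that agree nearby. Equations valid only inside a chart can
  thus be differentiated.\<close>

lemma frechet_derivative_cong:
  assumes "open S" "x \<in> S" "\<And>y. y \<in> S \<Longrightarrow> f y = g y"
  shows "frechet_derivative f (at x) = frechet_derivative g (at x)"
proof -
  have "(f has_derivative f') (at x) \<longleftrightarrow> (g has_derivative f') (at x)" for f'
    using has_derivative_transform_within_open[of f f' x UNIV S g]
      has_derivative_transform_within_open[of g f' x UNIV S f] assms by metis
  then show ?thesis by (simp add: frechet_derivative_def)
qed

text \<open>Leibniz rule for evaluation: the first term differentiates \<open>A\<close> with the
  argument frozen at \<open>X x\<close>, the second differentiates the argument. Both appear after
  expanding in \<open>Basis\<close>.\<close>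

lemma has_derivative_linear_apply:
  fixes A :: "'a::euclidean_space \<Rightarrow> 'c::euclidean_space \<Rightarrow> 'd::real_normed_vector"
  assumes "open S" "x \<in> S" "\<And>y. y \<in> S \<Longrightarrow> linear (A y)" "\<And>v. (\<lambda>y. A y v) differentiable (at x)"
    and X: "(X has_derivative X') (at x)"
  shows "((\<lambda>y. A y (X y)) has_derivative
      (\<lambda>u. frechet_derivative (\<lambda>y. A y (X x)) (at x) u + A x (X' u))) (at x)"
proof -
  have d: "((\<lambda>y. A y v) has_derivative frechet_derivative (\<lambda>y. A y v) (at x)) (at x)" for v
    by (rule frechet_derivative_works[THEN iffD1, OF assms(4)])
  have "((\<lambda>y. \<Sum>b\<in>Basis. (v \<bullet> b) *\<^sub>R A y b) has_derivative
      (\<lambda>u. \<Sum>b\<in>Basis. (v \<bullet> b) *\<^sub>R frechet_derivative (\<lambda>y. A y b) (at x) u)) (at x)" for v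
    by (intro has_derivative_sum has_derivative_scaleR_right d)
  then have "((\<lambda>y. A y v) has_derivative
      (\<lambda>u. \<Sum>b\<in>Basis. (v \<bullet> b) *\<^sub>R frechet_derivative (\<lambda>y. A y b) (at x) u)) (at x)" for v
    by (rule has_derivative_transform_within_open[OF _ assms(1,2)])
      (rule linear_basis_expansion[OF assms(3), symmetric])
  note e = frechet_derivative_eqI[OF this]
  have "((\<lambda>y. \<Sum>b\<in>Basis. (X y \<bullet> b) *\<^sub>R A y b) has_derivative
      (\<lambda>u. \<Sum>b\<in>Basis. (X x \<bullet> b) *\<^sub>R frechet_derivative (\<lambda>y. A y b) (at x) u + (X' u \<bullet> b) *\<^sub>R A x b)) (at x)"
    by (intro has_derivative_sum has_derivative_scaleR d has_derivative_inner_left X)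
  also have "(\<lambda>u. \<Sum>b\<in>Basis. (X x \<bullet> b) *\<^sub>R frechet_derivative (\<lambda>y. A y b) (at x) u + (X' u \<bullet> b) *\<^sub>R A x b)
     = (\<lambda>u. frechet_derivative (\<lambda>y. A y (X x)) (at x) u + A x (X' u))"
    unfolding e[of "X x"] linear_basis_expansion[OF assms(3)[OF assms(2)], of "X' u" for u]
    by (simp only: sum.distrib)
  finally show ?thesis
    by (rule has_derivative_transform_within_open[OF _ assms(1,2)])
      (rule linear_basis_expansion[OF assms(3), symmetric])
qed

lemma has_derivative_bilinear_apply:
  fixes B :: "'a::euclidean_space \<Rightarrow> 'c::euclidean_space \<Rightarrow> 'c \<Rightarrow> 'd::real_normed_vector"
  assumes S: "open S" "x \<in> S" and B: "\<And>y. y \<in> S \<Longrightarrow> bilinear (B y)"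
    and d: "\<And>u v. (\<lambda>y. B y u v) differentiable (at x)"
    and X: "(X has_derivative X') (at x)" and Y: "(Y has_derivative Y') (at x)"
  shows "((\<lambda>y. B y (X y) (Y y)) has_derivative
      (\<lambda>u. frechet_derivative (\<lambda>y. B y (X x) (Y x)) (at x) u + B x (X x) (Y' u) + B x (X' u) (Y x))) (at x)"
proof -
  have Yd: "((\<lambda>y. B y v (Y y)) has_derivative
      (\<lambda>u. frechet_derivative (\<lambda>y. B y v (Y x)) (at x) u + B x v (Y' u))) (at x)" for v
  proof (rule has_derivative_linear_apply[of S x "\<lambda>y. B y v" Y Y', OF S _ _ Y])
    show "linear (B y v)" if "y \<in> S" for y by (rule bilinear_imp_linear(1)[OF B[OF that]])
    show "(\<lambda>y. B y v w) differentiable (at x)" for w by (rule d)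
  qed
  have "((\<lambda>y. B y (X y) (Y y)) has_derivative
      (\<lambda>u. frechet_derivative (\<lambda>y. B y (X x) (Y y)) (at x) u + B x (X' u) (Y x))) (at x)"
  proof (rule has_derivative_linear_apply[of S x "\<lambda>y u. B y u (Y y)" X X', OF S _ _ X])
    show "linear (\<lambda>u. B y u (Y y))" if "y \<in> S" for y by (rule bilinear_imp_linear(2)[OF B[OF that]])
    show "(\<lambda>y. B y w (Y y)) differentiable (at x)" for w by (rule differentiableI[OF Yd])
  qed
  then show ?thesis unfolding frechet_derivative_eqI[OF Yd] .
qed

section \<open>Symmetry of second derivatives\<close>

lemma frechet_derivative_linear:
  "f differentiable (at x) \<Longrightarrow> linear (frechet_derivative f (at x))"
  by (rule has_derivative_linear, rule frechet_derivative_works[THEN iffD1])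

text \<open>Two applications of the mean value theorem to the second difference over a
  parallelogram: first along \<open>u\<close>, for the difference in the direction \<open>v\<close>,
  then along \<open>v\<close>, for the derivative in the direction \<open>u\<close>.\<close>

lemma mean_value_mixed_difference:
  fixes f :: "'a::euclidean_space \<Rightarrow> real"
  assumes f: "\<And>y. y \<in> ball x r \<Longrightarrow> f differentiable (at y)"
    and g: "\<And>y. y \<in> ball x r \<Longrightarrow> (\<lambda>y. frechet_derivative f (at y) u) differentiable (at y)"
    and h: "0 < h" "h * (norm u + norm v) < r"
  shows "\<exists>y. norm (y - x) \<le> h * (norm u + norm v) \<and>
     f (x + h *\<^sub>R u + h *\<^sub>R v) - f (x + h *\<^sub>R u) - f (x + h *\<^sub>R v) + f x
       = h * h * frechet_derivative (\<lambda>y. frechet_derivative f (at y) u) (at y) v"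
proof -
  define F where "F y = frechet_derivative f (at y) u" for y
  have n: "norm (a *\<^sub>R u + b *\<^sub>R v) \<le> h * (norm u + norm v)" if "0 \<le> a" "a \<le> h" "0 \<le> b" "b \<le> h" for a b
  proof -
    have "norm (a *\<^sub>R u + b *\<^sub>R v) \<le> a * norm u + b * norm v"
      using norm_triangle_ineq[of "a *\<^sub>R u" "b *\<^sub>R v"] that by simp
    also have "\<dots> \<le> h * norm u + h * norm v"
      using that by (intro add_mono mult_right_mono) auto
    finally show ?thesis by (simp add: algebra_simps)
  qed
  have inb: "x + a *\<^sub>R u + b *\<^sub>R v \<in> ball x r" if "0 \<le> a" "a \<le> h" "0 \<le> b" "b \<le> h" for a b
  proof -
    have "dist x (x + a *\<^sub>R u + b *\<^sub>R v) = norm (a *\<^sub>R u + b *\<^sub>R v)"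
      unfolding dist_norm by (subst norm_minus_commute) (simp only: add.assoc add_diff_cancel_left')
    then show ?thesis using n[OF that] h(2) by simp
  qed
  have d1: "((\<lambda>s. f (x + s *\<^sub>R u + b *\<^sub>R v)) has_real_derivative F (x + s *\<^sub>R u + b *\<^sub>R v)) (at s)"
    if "0 \<le> s" "s \<le> h" "0 \<le> b" "b \<le> h" for s b
  proof -
    have D: "(f has_derivative frechet_derivative f (at (x + s *\<^sub>R u + b *\<^sub>R v))) (at (x + s *\<^sub>R u + b *\<^sub>R v))"
      by (rule frechet_derivative_works[THEN iffD1, OF f[OF inb[OF that]]])
    have "((\<lambda>s. x + s *\<^sub>R u + b *\<^sub>R v) has_derivative (\<lambda>t. t *\<^sub>R u)) (at s)"
      by (auto intro!: derivative_eq_intros)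
    note has_derivative_compose[OF this, OF D]
    moreover have "(\<lambda>t. frechet_derivative f (at (x + s *\<^sub>R u + b *\<^sub>R v)) (t *\<^sub>R u))
        = (*) (F (x + s *\<^sub>R u + b *\<^sub>R v))"
      by (rule ext) (simp add: F_def linear_scale[OF has_derivative_linear[OF D]])
    ultimately show ?thesis
      unfolding has_field_derivative_def by (simp only:)
  qed
  have d2: "((\<lambda>s. F (x + a *\<^sub>R u + s *\<^sub>R v)) has_real_derivative
      frechet_derivative F (at (x + a *\<^sub>R u + s *\<^sub>R v)) v) (at s)"
    if "0 \<le> a" "a \<le> h" "0 \<le> s" "s \<le> h" for s a
  proof -
    have D: "(F has_derivative frechet_derivative F (at (x + a *\<^sub>R u + s *\<^sub>R v))) (at (x + a *\<^sub>R u + s *\<^sub>R v))"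
      unfolding F_def by (rule frechet_derivative_works[THEN iffD1, OF g[OF inb[OF that]]])
    have "((\<lambda>s. x + a *\<^sub>R u + s *\<^sub>R v) has_derivative (\<lambda>t. t *\<^sub>R v)) (at s)"
      by (auto intro!: derivative_eq_intros)
    note has_derivative_compose[OF this, OF D]
    moreover have "(\<lambda>t. frechet_derivative F (at (x + a *\<^sub>R u + s *\<^sub>R v)) (t *\<^sub>R v))
        = (*) (frechet_derivative F (at (x + a *\<^sub>R u + s *\<^sub>R v)) v)"
      by (rule ext) (simp add: linear_scale[OF has_derivative_linear[OF D]])
    ultimately show ?thesis
      unfolding has_field_derivative_def by (simp only:)
  qed
  \<comment> \<open>The terms with factor \<open>0\<close> keep all four corners in the common form
    of \<open>d1\<close>, whose parameter \<open>b\<close> is taken as \<open>h\<close> and as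
    \<open>0\<close>.\<close>
  have "\<exists>a>0. a < h \<and> (f (x + h *\<^sub>R u + h *\<^sub>R v) - f (x + h *\<^sub>R u + 0 *\<^sub>R v)) -
      (f (x + 0 *\<^sub>R u + h *\<^sub>R v) - f (x + 0 *\<^sub>R u + 0 *\<^sub>R v))
     = (h - 0) * (F (x + a *\<^sub>R u + h *\<^sub>R v) - F (x + a *\<^sub>R u + 0 *\<^sub>R v))"
    by (rule MVT2[OF h(1), of "\<lambda>s. f (x + s *\<^sub>R u + h *\<^sub>R v) - f (x + s *\<^sub>R u + 0 *\<^sub>R v)"
          "\<lambda>s. F (x + s *\<^sub>R u + h *\<^sub>R v) - F (x + s *\<^sub>R u + 0 *\<^sub>R v)"])
      (rule DERIV_diff; rule d1; use h(1) in simp)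
  then obtain a where a: "0 < a" "a < h" "f (x + h *\<^sub>R u + h *\<^sub>R v) - f (x + h *\<^sub>R u) - f (x + h *\<^sub>R v) + f x
      = h * (F (x + a *\<^sub>R u + h *\<^sub>R v) - F (x + a *\<^sub>R u))"
    by auto
  have "\<exists>b>0. b < h \<and> F (x + a *\<^sub>R u + h *\<^sub>R v) - F (x + a *\<^sub>R u + 0 *\<^sub>R v)
      = (h - 0) * frechet_derivative F (at (x + a *\<^sub>R u + b *\<^sub>R v)) v"
    by (rule MVT2[OF h(1), of "\<lambda>s. F (x + a *\<^sub>R u + s *\<^sub>R v)"
          "\<lambda>s. frechet_derivative F (at (x + a *\<^sub>R u + s *\<^sub>R v)) v"])
      (rule d2; use h(1) a in simp)
  then obtain b where b: "0 < b" "b < h" "F (x + a *\<^sub>R u + h *\<^sub>R v) - F (x + a *\<^sub>R u)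
      = h * frechet_derivative F (at (x + a *\<^sub>R u + b *\<^sub>R v)) v"
    by auto
  show ?thesis
    using n[of a b] a b unfolding F_def[symmetric]
    by (intro exI[of _ "x + a *\<^sub>R u + b *\<^sub>R v"]) (simp add: add.assoc)
qed

text \<open>The second difference does not change when \<open>u\<close> and \<open>v\<close> are
  exchanged. Both mixed derivatives therefore take equal values at points arbitrarily close to
  \<open>x\<close>, and continuity carries this to \<open>x\<close>.\<close>

lemma frechet_derivative_symmetric:
  fixes f :: "'a::euclidean_space \<Rightarrow> real"
  assumes S: "open S" "x \<in> S" and f: "smooth_on S f"
  shows "frechet_derivative (\<lambda>y. frechet_derivative f (at y) u) (at x) v
       = frechet_derivative (\<lambda>y. frechet_derivative f (at y) v) (at x) u"
proof -
  define H where "H u v y = frechet_derivative (\<lambda>y. frechet_derivative f (at y) u) (at y) v" for u v y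
  obtain r where r: "r > 0" "ball x r \<subseteq> S" using S open_contains_ball by blast
  have sm: "smooth_on S (\<lambda>y. frechet_derivative f (at y) u)" for u
    by (rule smooth_on_frechet_derivative[OF f])
  have "smooth_on S (H u v)" for u v
    unfolding H_def by (rule smooth_on_frechet_derivative[OF sm])
  then have cont: "isCont (H u v) x" for u v
    using smooth_on_imp_continuous_on[of S "H u v"] S by (simp add: continuous_on_eq_continuous_at)
  have "\<bar>H u v x - H v u x\<bar> \<le> 2 * e" if e: "e > 0" for e
  proof -
    obtain d where d: "d > 0" "\<And>y. dist y x < d \<Longrightarrow> \<bar>H u v y - H u v x\<bar> < e"
      using cont[of u v, unfolded continuous_at_eps_delta, rule_format, OF e] unfolding dist_real_def by metis
    obtain d' where d': "d' > 0" "\<And>y. dist y x < d' \<Longrightarrow> \<bar>H v u y - H v u x\<bar> < e"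
      using cont[of v u, unfolded continuous_at_eps_delta, rule_format, OF e] unfolding dist_real_def by metis
    \<comment> \<open>The step \<open>h\<close> is small enough for the parallelogram to lie in all
      three balls, of radii \<open>r\<close>, \<open>d\<close> and \<open>d'\<close>; the summand
      \<open>1\<close> keeps \<open>c\<close> positive when both directions vanish.\<close>
    define m where "m = min r (min d d')"
    define c where "c = norm u + norm v + 1"
    define h where "h = m / (2 * c)"
    have m: "m > 0" using r d d' by (simp add: m_def)
    have c: "c > 0" by (simp add: c_def add_nonneg_pos)
    then have h: "h > 0" using m by (simp add: h_def)
    have "h * c = m / 2" using c by (simp add: h_def)
    then have hm: "h * (norm u + norm v) < m"
      using h m unfolding c_def distrib_left by simp
    have f_diff: "f differentiable (at y)" if "y \<in> ball x r" for y
      by (rule smooth_on_imp_differentiable[OF f]) (use that r in auto)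
    have D_diff: "(\<lambda>y. frechet_derivative f (at y) w) differentiable (at y)" if "y \<in> ball x r" for y w
      by (rule smooth_on_imp_differentiable[OF sm]) (use that r in auto)
    have hr: "h * (norm u + norm v) < r" "h * (norm v + norm u) < r"
      "h * (norm u + norm v) < d" "h * (norm v + norm u) < d'"
      using hm by (simp_all add: m_def add.commute)
    note uv = mean_value_mixed_difference[of x r f u h v, folded H_def, OF f_diff D_diff h hr(1)]
    note vu = mean_value_mixed_difference[of x r f v h u, folded H_def, OF f_diff D_diff h hr(2)]
    obtain y where y: "norm (y - x) \<le> h * (norm u + norm v)"
      "f (x + h *\<^sub>R u + h *\<^sub>R v) - f (x + h *\<^sub>R u) - f (x + h *\<^sub>R v) + f x = h * h * H u v y"
      by (rule exE[OF uv]) (assumption, assumption, elim conjE)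
    obtain z where z: "norm (z - x) \<le> h * (norm v + norm u)"
      "f (x + h *\<^sub>R v + h *\<^sub>R u) - f (x + h *\<^sub>R v) - f (x + h *\<^sub>R u) + f x = h * h * H v u z"
      by (rule exE[OF vu]) (assumption, assumption, elim conjE)
    have "f (x + h *\<^sub>R u + h *\<^sub>R v) = f (x + h *\<^sub>R v + h *\<^sub>R u)"
      by (rule arg_cong[of _ _ f]) simp
    then have "h * h * H u v y = h * h * H v u z"
      using y(2) z(2) by linarith
    then have "H u v y = H v u z" using h by simp
    moreover have "\<bar>H u v y - H u v x\<bar> < e"
      by (rule d(2)) (use y(1) hr in \<open>simp add: dist_norm\<close>)
    moreover have "\<bar>H v u z - H v u x\<bar> < e"
      by (rule d'(2)) (use z(1) hr in \<open>simp add: dist_norm\<close>)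
    ultimately show ?thesis by linarith
  qed
  note bound = this
  have "\<bar>H u v x - H v u x\<bar> \<le> 0 + e" if "e > 0" for e
    using bound[of "e / 2"] that by simp
  then have "\<bar>H u v x - H v u x\<bar> \<le> 0" by (rule field_le_epsilon)
  then show ?thesis by (simp add: H_def)
qed

section \<open>Metrics and Levi-Civita connections in a chart\<close>

locale inner_form =
  fixes h :: "'e::euclidean_space \<Rightarrow> 'e \<Rightarrow> real"
  assumes bil: "bilinear h" and sym: "h u v = h v u" and pos: "v \<noteq> 0 \<Longrightarrow> 0 < h v v"
begin

lemmas linear_right = bilinear_imp_linear(1)[OF bil] and linear_left = bilinear_imp_linear(2)[OF bil]

lemmas form_simps =
  bilinear_ladd[OF bil] bilinear_radd[OF bil] bilinear_lsub[OF bil] bilinear_rsub[OF bil]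
  bilinear_lmul[OF bil] bilinear_rmul[OF bil] bilinear_lneg[OF bil] bilinear_rneg[OF bil]
  bilinear_lzero[OF bil] bilinear_rzero[OF bil]

lemma form_sum_left: "h (\<Sum>i\<in>I. f i) v = (\<Sum>i\<in>I. h (f i) v)"
  using linear_sum[OF linear_left] .

lemma form_sum_right: "h v (\<Sum>i\<in>I. f i) = (\<Sum>i\<in>I. h v (f i))"
  using linear_sum[OF linear_right] .

lemma form_eq_0_iff: "h v v = 0 \<longleftrightarrow> v = 0"
  using pos[of v] form_simps by force

lemma form_eqI:
  assumes "\<And>w. h u w = h v w"
  shows "u = v"
proof -
  have "h (u - v) (u - v) = 0" using assms by (simp add: form_simps)
  then show ?thesis by (simp add: form_eq_0_iff)
qed

text \<open>Orthonormality gives independence, and together with the cardinality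
  \<open>DIM('e)\<close> a spanning set. The difference \<open>w\<close> between a vector and its
  expansion is orthogonal to a spanning set, hence zero.\<close>

lemma orthonormal_basis_props:
  assumes "orthonormal_basis h B"
  shows orthonormal_finite: "finite B"
    and orthonormal_expansion: "v = (\<Sum>b\<in>B. h v b *\<^sub>R b)"
proof -
  have card: "card B = DIM('e)" and h: "\<And>u v. u \<in> B \<Longrightarrow> v \<in> B \<Longrightarrow> h u v = (if u = v then 1 else 0)"
    using assms by (auto simp: orthonormal_basis_def)
  show fin: "finite B" using card DIM_positive card_ge_0_finite by metis
  have coeff: "h (\<Sum>b\<in>B. c b *\<^sub>R b) u = c u" if "u \<in> B" for c u
  proof -
    have "h (\<Sum>b\<in>B. c b *\<^sub>R b) u = (\<Sum>b\<in>B. if b = u then c b else 0)"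
      unfolding form_sum_left by (rule sum.cong) (auto simp: form_simps h that)
    then show ?thesis using that fin by simp
  qed
  have "independent B"
  proof
    assume "dependent B"
    then obtain c where "\<exists>b\<in>B. c b \<noteq> 0" "(\<Sum>b\<in>B. c b *\<^sub>R b) = 0"
      using dependent_finite[OF fin] by metis
    then show False using coeff[of _ c] form_simps by metis
  qed
  then have span: "span B = UNIV"
    using card card_eq_dim[of B UNIV] fin by auto
  define w where "w = v - (\<Sum>b\<in>B. h v b *\<^sub>R b)"
  have "h w u = 0" if "u \<in> B" for u
    by (simp add: w_def form_simps coeff[OF that])
  then have "h w u = 0" if "u \<in> span B" for u
    using that linear_eq_0_on_span[OF linear_right[of w]] by metis
  then have "w = 0" using span form_eq_0_iff by blast
  then show "v = (\<Sum>b\<in>B. h v b *\<^sub>R b)" by (simp add: w_def)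
qed

text \<open>The matrix of the change of basis is orthogonal: expanding \<open>B\<close> in
  \<open>C\<close>, the coefficients combine to \<open>h c d\<close>, which is the Kronecker delta
  on \<open>C\<close>.\<close>

lemma orthonormal_sum_eq:
  fixes T :: "'e \<Rightarrow> 'e \<Rightarrow> 'b::real_vector"
  assumes B: "orthonormal_basis h B" and C: "orthonormal_basis h C" and T: "bilinear T"
  shows "(\<Sum>b\<in>B. T b b) = (\<Sum>c\<in>C. T c c)"
proof -
  note fin = orthonormal_finite[OF B] orthonormal_finite[OF C]
  have exp: "T b b = (\<Sum>c\<in>C. \<Sum>d\<in>C. (h b c * h b d) *\<^sub>R T c d)" for b
  proof -
    have "T b b = T (\<Sum>c\<in>C. h b c *\<^sub>R c) (\<Sum>d\<in>C. h b d *\<^sub>R d)"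
      using orthonormal_expansion[OF C, of b] by metis
    then show ?thesis
      by (simp add: bilinear_sum[OF T] sum.cartesian_product bilinear_lmul[OF T] bilinear_rmul[OF T] fin mult.commute)
  qed
  have coeff: "(\<Sum>b\<in>B. h b c * h b d) = h c d" for c d
  proof -
    have "h c d = h (\<Sum>b\<in>B. h c b *\<^sub>R b) d"
      using orthonormal_expansion[OF B, of c] by metis
    also have "\<dots> = (\<Sum>b\<in>B. h b c * h b d)"
      unfolding form_sum_left by (rule sum.cong) (simp_all add: form_simps sym)
    finally show ?thesis by simp
  qed
  have "(\<Sum>b\<in>B. T b b) = (\<Sum>c\<in>C. \<Sum>d\<in>C. (\<Sum>b\<in>B. h b c * h b d) *\<^sub>R T c d)"
    unfolding exp scaleR_left.sum
    by (subst sum.swap, rule sum.cong[OF refl], rule sum.swap)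
  also have "\<dots> = (\<Sum>c\<in>C. \<Sum>d\<in>C. if c = d then T c d else 0)"
    unfolding coeff using C by (intro sum.cong) (auto simp: orthonormal_basis_def)
  also have "\<dots> = (\<Sum>c\<in>C. T c c)"
    using fin by simp
  finally show ?thesis .
qed

text \<open>The given basis witnesses that the basis chosen in \<open>metric_trace\<close> is
  orthonormal; bilinearity then makes the choice irrelevant.\<close>

lemma metric_trace_eq:
  assumes "orthonormal_basis h B" "bilinear T"
  shows "metric_trace h T = (\<Sum>b\<in>B. T b b)"
  unfolding metric_trace_def
  by (rule orthonormal_sum_eq[OF someI assms]) (rule assms)

end

section \<open>Riemannian metrics on an open set and smooth orthogonal frames\<close>

locale metric_chart =
  fixes V :: "'e::euclidean_space set" and g :: "'e \<Rightarrow> 'e \<Rightarrow> 'e \<Rightarrow> real"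
  assumes open_V: "open V"
    and inner: "x \<in> V \<Longrightarrow> inner_form (g x)"
    and smooth_g: "smooth_on V (\<lambda>x. g x u v)"
begin

lemmas g_bil = inner_form.bil[OF inner] and g_sym = inner_form.sym[OF inner]

lemma smooth_on_metric:
  assumes "smooth_on V X" "smooth_on V Y"
  shows "smooth_on V (\<lambda>x. g x (X x) (Y x))"
  by (rule smooth_on_bilinear_apply[OF open_V g_bil smooth_g assms])

text \<open>The fields are left unnormalised, so that they are built from the metric by ring
  operations and division alone. The condition on spans is what the induction over \<open>S\<close>
  in the Gram-Schmidt process needs.\<close>

definition orthogonal_frame :: "'e set \<Rightarrow> ('e \<Rightarrow> 'e \<Rightarrow> 'e) \<Rightarrow> bool" where
  "orthogonal_frame S e \<longleftrightarrow> (\<forall>b\<in>S. smooth_on V (e b)) \<and>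
    (\<forall>x\<in>V. (\<forall>b\<in>S. e b x \<noteq> 0) \<and> (\<forall>b\<in>S. \<forall>c\<in>S. b \<noteq> c \<longrightarrow> g x (e b x) (e c x) = 0) \<and>
       span ((\<lambda>b. e b x) ` S) = span S)"

lemma orthogonal_frameD:
  assumes "orthogonal_frame S e"
  shows "b \<in> S \<Longrightarrow> smooth_on V (e b)"
    and "x \<in> V \<Longrightarrow> b \<in> S \<Longrightarrow> 0 < g x (e b x) (e b x)"
    and "x \<in> V \<Longrightarrow> b \<in> S \<Longrightarrow> c \<in> S \<Longrightarrow> b \<noteq> c \<Longrightarrow> g x (e b x) (e c x) = 0"
    and "x \<in> V \<Longrightarrow> span ((\<lambda>b. e b x) ` S) = span S"
  using assms inner_form.pos[OF inner] by (simp_all add: orthogonal_frame_def)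

text \<open>Gram-Schmidt carried out at all points simultaneously, starting from the constant fields
  in \<open>S\<close>.\<close>

lemma orthogonal_frame_exists:
  assumes "finite S" "independent S"
  shows "\<exists>e. orthogonal_frame S e"
  using assms
proof (induction S rule: finite_induct)
  case empty
  then show ?case by (simp add: orthogonal_frame_def)
next
  case (insert c S)
  have ind: "independent S" "c \<notin> span S"
    using insert.prems insert.hyps by (auto simp: independent_insert)
  obtain e where e: "orthogonal_frame S e"
    using insert.IH[OF ind(1)] by (elim exE)
  note sm = orthogonal_frameD(1)[OF e] and orth = orthogonal_frameD(3)[OF e]
    and span = orthogonal_frameD(4)[OF e]
  have nz: "e b x \<noteq> 0" if "x \<in> V" "b \<in> S" for x b
    using e that by (simp add: orthogonal_frame_def)
  \<comment> \<open>\<open>w\<close> is the pointwise orthogonal projection of the constant field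
    \<open>c\<close> onto the span of the earlier fields. That span is \<open>span S\<close>, which
    does not contain \<open>c\<close>, so \<open>n\<close> vanishes nowhere.\<close>
  define w where "w x = (\<Sum>b\<in>S. (g x c (e b x) / g x (e b x) (e b x)) *\<^sub>R e b x)" for x
  define n where "n x = c - w x" for x
  define e' where "e' = e(c := n)"
  have e'[simp]: "e' c = n" "\<And>b. b \<in> S \<Longrightarrow> e' b = e b"
    using insert.hyps by (auto simp: e'_def)
  have nz': "g x (e b x) (e b x) \<noteq> 0" if "x \<in> V" "b \<in> S" for x b
    using orthogonal_frameD(2)[OF e that] by simp
  have smw: "smooth_on V w"
    unfolding w_def
    by (intro smooth_on_sum smooth_on_scaleR smooth_on_divide smooth_on_metric smooth_on_const open_V sm nz')
  have smn: "smooth_on V n"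
    unfolding n_def by (intro smooth_on_diff smooth_on_const open_V smw)
  have w: "w x \<in> span S" if "x \<in> V" for x
  proof -
    have "w x \<in> span ((\<lambda>b. e b x) ` S)"
      unfolding w_def by (intro span_sum span_scale span_base imageI)
    then show ?thesis using span[OF that] by simp
  qed
  have n0: "n x \<noteq> 0" if "x \<in> V" for x
    using w[OF that] ind(2) by (auto simp: n_def)
  have on: "g x (e b x) (n x) = 0" if x: "x \<in> V" and b: "b \<in> S" for x b
  proof -
    interpret inner_form "g x" by (rule inner[OF x])
    have "g x (e b x) (w x) = (\<Sum>d\<in>S. if d = b then g x c (e b x) else 0)"
      unfolding w_def form_sum_right
      by (rule sum.cong) (auto simp: form_simps orth x b nz')
    also have "\<dots> = g x c (e b x)" using b insert.hyps by simp
    finally show ?thesis by (simp add: n_def form_simps sym)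
  qed
  have "g x (e' b x) (e' d x) = 0" if x: "x \<in> V" and "b \<in> insert c S" "d \<in> insert c S" "b \<noteq> d" for x b d
    using that on[OF x] orth[OF x] g_sym[OF x] by auto
  moreover have "span ((\<lambda>b. e' b x) ` insert c S) = span (insert c S)" if x: "x \<in> V" for x
  proof -
    have "(\<lambda>b. e' b x) ` insert c S = insert (n x) ((\<lambda>b. e b x) ` S)" by auto
    moreover have "span (insert (n x) ((\<lambda>b. e b x) ` S)) = span (insert c ((\<lambda>b. e b x) ` S))"
      by (rule eq_span_insert_eq) (use w[OF x] span[OF x] in \<open>simp add: n_def span_neg\<close>)
    moreover have "span (insert c ((\<lambda>b. e b x) ` S)) = span (insert c S)"
      unfolding span_insert span[OF x] ..
    ultimately show ?thesis by simp
  qed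
  moreover have "smooth_on V (e' b)" if "b \<in> insert c S" for b using that sm smn by auto
  moreover have "e' b x \<noteq> 0" if "x \<in> V" "b \<in> insert c S" for x b using nz n0 that by auto
  ultimately have "orthogonal_frame (insert c S) e'"
    unfolding orthogonal_frame_def by (intro conjI ballI impI)
  then show ?case by (rule exI[of _ e'])
qed

lemma orthogonal_frame_Basis: "\<exists>e. orthogonal_frame Basis e"
  by (rule orthogonal_frame_exists[OF finite_Basis independent_Basis])

lemma orthonormal_basis_exists:
  assumes x: "x \<in> V"
  shows "\<exists>B. orthonormal_basis (g x) B"
proof -
  interpret inner_form "g x" by (rule inner[OF x])
  obtain e where e: "orthogonal_frame Basis e"
    using orthogonal_frame_Basis by (elim exE)
  define F where "F b = (1 / sqrt (g x (e b x) (e b x))) *\<^sub>R e b x" for b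
  have F: "g x (F b) (F c) = (if b = c then 1 else 0)" if "b \<in> Basis" "c \<in> Basis" for b c
    using orthogonal_frameD(2)[OF e x that(1)] orthogonal_frameD(3)[OF e x that] by (auto simp: F_def form_simps)
  then have "inj_on F Basis" by (intro inj_onI) (metis zero_neq_one)
  then have "orthonormal_basis (g x) (F ` Basis)"
    unfolding orthonormal_basis_def by (auto simp: card_image F inj_on_eq_iff)
  then show ?thesis by blast
qed

section \<open>The Koszul formula; existence and uniqueness of the Levi-Civita connection\<close>

text \<open>The Koszul expression for chart-constant fields: their Lie brackets vanish, so only the
  derivatives of the metric coefficients remain.\<close>

definition koszul :: "'e \<Rightarrow> 'e \<Rightarrow> 'e \<Rightarrow> 'e \<Rightarrow> real" where
  "koszul x u v w =
     (frechet_derivative (\<lambda>y. g y v w) (at x) u + frechet_derivative (\<lambda>y. g y u w) (at x) v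
       - frechet_derivative (\<lambda>y. g y u v) (at x) w) / 2"

lemma g_differentiable: "x \<in> V \<Longrightarrow> (\<lambda>y. g y u v) differentiable (at x)"
  by (rule smooth_on_imp_differentiable[OF smooth_g])

lemma linear_frechet_derivative_g: "x \<in> V \<Longrightarrow> linear (frechet_derivative (\<lambda>y. g y u v) (at x))"
  by (rule frechet_derivative_linear[OF g_differentiable])

lemma has_derivative_g:
  "x \<in> V \<Longrightarrow> ((\<lambda>y. g y u v) has_derivative frechet_derivative (\<lambda>y. g y u v) (at x)) (at x)"
  by (rule frechet_derivative_works[THEN iffD1, OF g_differentiable])

lemma linear_frechet_derivative_g_right:
  assumes x: "x \<in> V"
  shows "linear (\<lambda>v. frechet_derivative (\<lambda>y. g y u v) (at x) w)"
proof (rule linearI)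
  fix v v' and c :: real
  have "((\<lambda>y. g y u v + g y u v') has_derivative
      (\<lambda>w. frechet_derivative (\<lambda>y. g y u v) (at x) w + frechet_derivative (\<lambda>y. g y u v') (at x) w)) (at x)"
    by (rule has_derivative_add[OF has_derivative_g[OF x] has_derivative_g[OF x]])
  moreover have "frechet_derivative (\<lambda>y. g y u (v + v')) (at x) = frechet_derivative (\<lambda>y. g y u v + g y u v') (at x)"
    by (rule frechet_derivative_cong[OF open_V x]) (rule bilinear_radd[OF g_bil])
  ultimately show "frechet_derivative (\<lambda>y. g y u (v + v')) (at x) w
      = frechet_derivative (\<lambda>y. g y u v) (at x) w + frechet_derivative (\<lambda>y. g y u v') (at x) w"
    by (simp add: frechet_derivative_eqI)
  have "((\<lambda>y. c *\<^sub>R g y u v) has_derivative (\<lambda>w. c *\<^sub>R frechet_derivative (\<lambda>y. g y u v) (at x) w)) (at x)"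
    by (rule has_derivative_scaleR_right[OF has_derivative_g[OF x]])
  moreover have "frechet_derivative (\<lambda>y. g y u (c *\<^sub>R v)) (at x) = frechet_derivative (\<lambda>y. c *\<^sub>R g y u v) (at x)"
    by (rule frechet_derivative_cong[OF open_V x]) (simp add: bilinear_rmul[OF g_bil])
  ultimately show "frechet_derivative (\<lambda>y. g y u (c *\<^sub>R v)) (at x) w
      = c *\<^sub>R frechet_derivative (\<lambda>y. g y u v) (at x) w"
    by (simp add: frechet_derivative_eqI)
qed

lemma frechet_derivative_g_sym:
  assumes "x \<in> V"
  shows "frechet_derivative (\<lambda>y. g y u v) (at x) = frechet_derivative (\<lambda>y. g y v u) (at x)"
  by (rule frechet_derivative_cong[OF open_V assms]) (rule g_sym)

lemma linear_frechet_derivative_g_left: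
  assumes x: "x \<in> V"
  shows "linear (\<lambda>v. frechet_derivative (\<lambda>y. g y v u) (at x) w)"
  using linear_frechet_derivative_g_right[OF x, of u w] by (simp add: frechet_derivative_g_sym[OF x, of u])

lemma linear_koszul:
  assumes x: "x \<in> V"
  shows "linear (koszul x u v)" "linear (\<lambda>v. koszul x u v w)" "linear (\<lambda>u. koszul x u v w)"
proof -
  note l = linear_frechet_derivative_g[OF x] linear_frechet_derivative_g_right[OF x]
    linear_frechet_derivative_g_left[OF x]
  show "linear (koszul x u v)" "linear (\<lambda>v. koszul x u v w)" "linear (\<lambda>u. koszul x u v w)"
    unfolding koszul_def
    by (rule linearI; simp add: linear_add[OF l(1)] linear_scale[OF l(1)] linear_add[OF l(2)] linear_scale[OF l(2)]
          linear_add[OF l(3)] linear_scale[OF l(3)] field_simps)+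
qed

lemma koszul_commute: "x \<in> V \<Longrightarrow> koszul x u v w = koszul x v u w"
  by (simp add: koszul_def frechet_derivative_g_sym[of x u v])

lemma koszul_compat:
  "x \<in> V \<Longrightarrow> koszul x u v w + koszul x u w v = frechet_derivative (\<lambda>y. g y v w) (at x) u"
  using frechet_derivative_g_sym[of x w v] by (simp add: koszul_def field_simps)

text \<open>The conditions are needed on constant fields only. For general fields, the torsion
  equation acquires exactly the terms of the Lie bracket, and compatibility those of the product
  rule.\<close>

lemma is_levi_civitaI:
  assumes bil: "\<And>x. x \<in> V \<Longrightarrow> bilinear (\<Gamma> x)" and sm: "\<And>u v. smooth_on V (\<lambda>x. \<Gamma> x u v)"
    and torsion: "\<And>x u v. x \<in> V \<Longrightarrow> \<Gamma> x u v = \<Gamma> x v u"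
    and compat: "\<And>x u v w. x \<in> V \<Longrightarrow>
      frechet_derivative (\<lambda>y. g y v w) (at x) u = g x (\<Gamma> x u v) w + g x v (\<Gamma> x u w)"
  shows "is_levi_civita V g \<Gamma>"
proof -
  have "nabla \<Gamma> X Y x - nabla \<Gamma> Y X x = lie_bracket X Y x" if "x \<in> V" for X Y x
    using torsion[OF that, of "X x"] by (simp add: nabla_def lie_bracket_def)
  moreover have "frechet_derivative (\<lambda>y. g y (Y y) (Z y)) (at x) (X x)
      = g x (nabla \<Gamma> X Y x) (Z x) + g x (Y x) (nabla \<Gamma> X Z x)"
    if "smooth_on V Y" "smooth_on V Z" and x: "x \<in> V" for X Y Z x
  proof -
    have "((\<lambda>y. g y (Y y) (Z y)) has_derivative
      (\<lambda>u. frechet_derivative (\<lambda>y. g y (Y x) (Z x)) (at x) u + g x (Y x) (frechet_derivative Z (at x) u)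
          + g x (frechet_derivative Y (at x) u) (Z x))) (at x)"
      by (rule has_derivative_bilinear_apply[of V x g, OF open_V x g_bil g_differentiable[OF x]
            smooth_on_differentiable[OF that(1) x] smooth_on_differentiable[OF that(2) x]])
    then show ?thesis
      by (simp add: frechet_derivative_eqI compat[OF x] nabla_def bilinear_ladd[OF g_bil[OF x]]
          bilinear_radd[OF g_bil[OF x]])
  qed
  ultimately show ?thesis
    unfolding is_levi_civita_def by (intro conjI ballI allI impI bil sm)
qed

lemma is_levi_civitaD:
  assumes L: "is_levi_civita V g \<Gamma>"
  shows levi_civita_bilinear: "x \<in> V \<Longrightarrow> bilinear (\<Gamma> x)"
    and levi_civita_smooth: "smooth_on V (\<lambda>x. \<Gamma> x u v)"
    and levi_civita_torsion: "x \<in> V \<Longrightarrow> \<Gamma> x u v = \<Gamma> x v u"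
    and levi_civita_compat: "x \<in> V \<Longrightarrow> smooth_on V Y \<Longrightarrow> smooth_on V Z \<Longrightarrow>
      frechet_derivative (\<lambda>y. g y (Y y) (Z y)) (at x) u
        = g x (nabla \<Gamma> (\<lambda>_. u) Y x) (Z x) + g x (Y x) (nabla \<Gamma> (\<lambda>_. u) Z x)"
proof -
  show "x \<in> V \<Longrightarrow> bilinear (\<Gamma> x)" "smooth_on V (\<lambda>x. \<Gamma> x u v)"
    using L by (simp_all add: is_levi_civita_def)
  have c: "smooth_on V (\<lambda>_. u)" for u :: 'e by (rule smooth_on_const[OF open_V])
  have tor: "\<forall>X Y. smooth_on V X \<longrightarrow> smooth_on V Y \<longrightarrow>
        (\<forall>x\<in>V. nabla \<Gamma> X Y x - nabla \<Gamma> Y X x = lie_bracket X Y x)"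
    using L unfolding is_levi_civita_def by (elim conjE)
  have comp: "\<forall>X Y Z. smooth_on V X \<longrightarrow> smooth_on V Y \<longrightarrow> smooth_on V Z \<longrightarrow>
        (\<forall>x\<in>V. frechet_derivative (\<lambda>y. g y (Y y) (Z y)) (at x) (X x)
                 = g x (nabla \<Gamma> X Y x) (Z x) + g x (Y x) (nabla \<Gamma> X Z x))"
    using L unfolding is_levi_civita_def by (elim conjE)
  show "\<Gamma> x u v = \<Gamma> x v u" if "x \<in> V"
    using tor[rule_format, of "\<lambda>_. u" "\<lambda>_. v" x, OF c c that]
    by (simp add: nabla_def lie_bracket_def frechet_derivative_const)
  show "frechet_derivative (\<lambda>y. g y (Y y) (Z y)) (at x) u
        = g x (nabla \<Gamma> (\<lambda>_. u) Y x) (Z x) + g x (Y x) (nabla \<Gamma> (\<lambda>_. u) Z x)"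
    if "x \<in> V" "smooth_on V Y" "smooth_on V Z"
    using comp[rule_format, of "\<lambda>_. u" Y Z x, OF c that(2,3,1)] by simp
qed

lemma levi_civita_compat_const:
  assumes "is_levi_civita V g \<Gamma>" "x \<in> V"
  shows "frechet_derivative (\<lambda>y. g y v w) (at x) u = g x (\<Gamma> x u v) w + g x v (\<Gamma> x u w)"
  using levi_civita_compat[OF assms, of "\<lambda>_. v" "\<lambda>_. w" u]
  by (simp add: smooth_on_const[OF open_V] nabla_def frechet_derivative_const)

text \<open>Compatibility turns the three derivatives of \<open>g\<close> into six terms; by
  symmetry of \<Gamma> four of them cancel and the other two coincide. Uniqueness of the connection
  follows by nondegeneracy.\<close>

lemma levi_civita_koszul:
  assumes L: "is_levi_civita V g \<Gamma>" and x: "x \<in> V"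
  shows "g x (\<Gamma> x u v) w = koszul x u v w"
  unfolding koszul_def levi_civita_compat_const[OF L x]
  using levi_civita_torsion[OF L x] g_sym[OF x] by (simp add: field_simps)

lemma levi_civita_unique:
  assumes "is_levi_civita V g \<Gamma>" "is_levi_civita V g \<Gamma>'" "x \<in> V"
  shows "\<Gamma> x u v = \<Gamma>' x u v"
  by (rule inner_form.form_eqI[OF inner[OF assms(3)]])
    (simp only: levi_civita_koszul[OF assms(1,3)] levi_civita_koszul[OF assms(2,3)])

text \<open>\<Gamma> is the vector that represents the linear form \<open>koszul x u v\<close> with
  respect to \<open>g x\<close>. Writing it in a smooth orthogonal frame makes its smoothness
  visible.\<close>

lemma levi_civita_exists: "\<exists>\<Gamma>. is_levi_civita V g \<Gamma>"
proof -
  obtain e where e: "orthogonal_frame Basis e"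
    using orthogonal_frame_Basis by (elim exE)
  note sm = orthogonal_frameD(1)[OF e] and epos = orthogonal_frameD(2)[OF e]
    and orth = orthogonal_frameD(3)[OF e]
  have span: "span ((\<lambda>b. e b x) ` Basis) = UNIV" if "x \<in> V" for x
    using orthogonal_frameD(4)[OF e that] by simp
  define \<Gamma> where "\<Gamma> x u v = (\<Sum>b\<in>Basis. (koszul x u v (e b x) / g x (e b x) (e b x)) *\<^sub>R e b x)" for x u v
  have \<Gamma>: "g x (\<Gamma> x u v) w = koszul x u v w" if x: "x \<in> V" for x u v w
  proof -
    interpret inner_form "g x" by (rule inner[OF x])
    have "g x (\<Gamma> x u v) (e c x) = koszul x u v (e c x)" if c: "c \<in> Basis" for c
    proof -
      have "g x (\<Gamma> x u v) (e c x) = (\<Sum>b\<in>Basis. if b = c then koszul x u v (e c x) else 0)"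
        unfolding \<Gamma>_def form_sum_left
        by (rule sum.cong) (use epos[OF x c] in \<open>auto simp: form_simps orth x c\<close>)
      then show ?thesis using c by simp
    qed
    \<comment> \<open>Both sides are linear in \<open>w\<close> and agree on the frame, which spans
      the whole space at each point.\<close>
    then have "g x (\<Gamma> x u v) w = koszul x u v w" if "w \<in> (\<lambda>b. e b x) ` Basis" for w
      using that by (elim imageE) (simp only:)
    then show ?thesis
      by (rule linear_eq_on_span[OF linear_right linear_koszul(1)[OF x], of "(\<lambda>b. e b x) ` Basis"])
        (simp_all only: span[OF x] UNIV_I)
  qed
  have "is_levi_civita V g \<Gamma>"
  proof (rule is_levi_civitaI)
    fix x assume x: "x \<in> V"
    show "bilinear (\<Gamma> x)"
      unfolding bilinear_def
      by (intro allI conjI linearI)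
        (simp_all add: \<Gamma>_def linear_add[OF linear_koszul(2)[OF x]] linear_add[OF linear_koszul(3)[OF x]]
          linear_scale[OF linear_koszul(2)[OF x]] linear_scale[OF linear_koszul(3)[OF x]]
          add_divide_distrib scaleR_add_left sum.distrib scaleR_sum_right)
    fix u v w
    show "\<Gamma> x u v = \<Gamma> x v u" by (simp add: \<Gamma>_def koszul_commute[OF x, of u])
    show "frechet_derivative (\<lambda>y. g y v w) (at x) u = g x (\<Gamma> x u v) w + g x v (\<Gamma> x u w)"
      using \<Gamma>[OF x, of u v w] \<Gamma>[OF x, of u w v] koszul_compat[OF x, of u v w] g_sym[OF x, of v "\<Gamma> x u w"] by simp
  next
    fix u v
    have sK: "smooth_on V (\<lambda>x. koszul x u v w)" for w
      unfolding koszul_def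
      by (intro smooth_on_divide smooth_on_diff smooth_on_add smooth_on_frechet_derivative smooth_on_const
          open_V smooth_g) simp
    have K: "smooth_on V (\<lambda>x. koszul x u v (e b x))" if "b \<in> Basis" for b
      by (rule smooth_on_linear_apply[of V "\<lambda>x. koszul x u v" "e b", OF open_V linear_koszul(1) sK sm[OF that]])
    show "smooth_on V (\<lambda>x. \<Gamma> x u v)"
      unfolding \<Gamma>_def
      by (intro smooth_on_sum smooth_on_scaleR smooth_on_divide smooth_on_metric open_V K sm)
        (simp_all add: epos less_imp_neq[OF epos, symmetric])
  qed
  then show ?thesis by (rule exI[of _ \<Gamma>])
qed

lemma is_levi_civita_levi_civita: "is_levi_civita V g (levi_civita V g)"
  unfolding levi_civita_def using someI_ex[OF levi_civita_exists] .

end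

section \<open>Almost Hermitian structures in a chart\<close>

locale levi_civita_chart = metric_chart V g
  for V :: "'e::euclidean_space set" and g +
  fixes \<Gamma> :: "'e \<Rightarrow> 'e \<Rightarrow> 'e \<Rightarrow> 'e"
  assumes lc: "is_levi_civita V g \<Gamma>"
begin

lemmas \<Gamma>_bil = levi_civita_bilinear[OF lc] and \<Gamma>_smooth = levi_civita_smooth[OF lc]
  and \<Gamma>_sym = levi_civita_torsion[OF lc] and \<Gamma>_compat = levi_civita_compat[OF lc]

abbreviation N :: "'e \<Rightarrow> ('e \<Rightarrow> 'e) \<Rightarrow> 'e \<Rightarrow> 'e" where
  "N s X \<equiv> nabla \<Gamma> (\<lambda>_. s) X"

lemma N_const: "N s (\<lambda>_. v) x = \<Gamma> x s v"
  by (simp add: nabla_def frechet_derivative_const)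

lemma N_cong:
  assumes "x \<in> V" "\<And>y. y \<in> V \<Longrightarrow> X y = Y y"
  shows "N s X x = N s Y x"
  by (simp only: nabla_def frechet_derivative_cong[OF open_V assms] assms)

lemma N_uminus:
  assumes "x \<in> V" "smooth_on V X"
  shows "N s (\<lambda>y. - X y) x = - N s X x"
  by (simp add: nabla_def frechet_derivative_eqI[OF has_derivative_minus[OF smooth_on_differentiable[OF assms(2,1)]]]
      bilinear_rneg[OF \<Gamma>_bil[OF assms(1)]])

lemma N_add:
  assumes "x \<in> V" "smooth_on V X" "smooth_on V Y"
  shows "N s (\<lambda>y. X y + Y y) x = N s X x + N s Y x"
  by (simp add: nabla_def bilinear_radd[OF \<Gamma>_bil[OF assms(1)]]
      frechet_derivative_eqI[OF has_derivative_add[OF smooth_on_differentiable[OF assms(2,1)] smooth_on_differentiable[OF assms(3,1)]]])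

lemma N_scale:
  assumes "x \<in> V" "smooth_on V X"
  shows "N s (\<lambda>y. c *\<^sub>R X y) x = c *\<^sub>R N s X x"
  by (simp add: nabla_def bilinear_rmul[OF \<Gamma>_bil[OF assms(1)]] scaleR_add_right
      frechet_derivative_eqI[OF has_derivative_scaleR_right[OF smooth_on_differentiable[OF assms(2,1)]]])

lemma N_linear_direction:
  assumes "x \<in> V" "smooth_on V X"
  shows "linear (\<lambda>s. N s X x)"
proof -
  note l = frechet_derivative_linear[OF smooth_on_imp_differentiable[OF assms(2,1)]]
    and b = bilinear_imp_linear(2)[OF \<Gamma>_bil[OF assms(1)]]
  show ?thesis
    unfolding nabla_def by (rule linear_compose_add[OF l b])
qed

lemma smooth_on_N:
  assumes "smooth_on V X"
  shows "smooth_on V (N s X)"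
proof -
  have "smooth_on V (\<lambda>x. \<Gamma> x s (X x))"
    by (rule smooth_on_bilinear_apply[of V \<Gamma> "\<lambda>_. s" X, OF open_V \<Gamma>_bil \<Gamma>_smooth smooth_on_const[OF open_V] assms])
  then show ?thesis
    unfolding nabla_def[abs_def] by (rule smooth_on_add[OF open_V smooth_on_frechet_derivative[OF assms]])
qed

end

section \<open>First and second covariant derivatives of an almost complex structure\<close>

locale hermitian_chart = levi_civita_chart V g \<Gamma>
  for V :: "'e::euclidean_space set" and g \<Gamma> +
  fixes J :: "'e \<Rightarrow> 'e \<Rightarrow> 'e"
  assumes J_linear: "x \<in> V \<Longrightarrow> linear (J x)"
    and J_smooth: "smooth_on V (\<lambda>x. J x v)"
    and JJ: "x \<in> V \<Longrightarrow> J x (J x v) = - v"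
    and gJ: "x \<in> V \<Longrightarrow> g x (J x u) (J x v) = g x u v"
begin

abbreviation P :: "'e \<Rightarrow> 'e \<Rightarrow> 'e \<Rightarrow> 'e" where
  "P x u v \<equiv> nabla_end \<Gamma> (\<lambda>_. u) J x v"

abbreviation A :: "'e \<Rightarrow> 'e \<Rightarrow> 'e \<Rightarrow> 'e \<Rightarrow> 'e" where
  "A x s u v \<equiv> nabla2_end \<Gamma> (\<lambda>_. s) (\<lambda>_. u) J x v"

lemmas J_simps = linear_add[OF J_linear] linear_scale[OF J_linear] linear_neg[OF J_linear]
  linear_diff[OF J_linear] linear_0[OF J_linear]

lemma P_eq: "P x u v = N u (\<lambda>y. J y v) x - J x (\<Gamma> x u v)"
  by (simp add: nabla_end_def N_const)

lemma smooth_on_J_apply: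
  assumes "smooth_on V X"
  shows "smooth_on V (\<lambda>y. J y (X y))"
  by (rule smooth_on_linear_apply[OF open_V J_linear J_smooth assms])

lemma smooth_on_P: "smooth_on V (\<lambda>x. P x u v)"
  unfolding P_eq
  by (intro smooth_on_diff smooth_on_N smooth_on_J_apply open_V J_smooth \<Gamma>_smooth)

lemma linear_P_right:
  assumes x: "x \<in> V"
  shows "linear (P x u)"
proof (rule linearI)
  fix v w and c :: real
  have "N u (\<lambda>y. J y (v + w)) x = N u (\<lambda>y. J y v + J y w) x"
    by (rule N_cong[OF x]) (simp add: J_simps)
  then show "P x u (v + w) = P x u v + P x u w"
    by (simp add: P_eq N_add[OF x J_smooth J_smooth] bilinear_radd[OF \<Gamma>_bil[OF x]] J_simps[OF x])
  have "N u (\<lambda>y. J y (c *\<^sub>R v)) x = N u (\<lambda>y. c *\<^sub>R J y v) x"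
    by (rule N_cong[OF x]) (simp add: J_simps)
  then show "P x u (c *\<^sub>R v) = c *\<^sub>R P x u v"
    by (simp add: P_eq N_scale[OF x J_smooth] bilinear_rmul[OF \<Gamma>_bil[OF x]] J_simps[OF x] scaleR_diff_right)
qed

lemma linear_P_left:
  assumes x: "x \<in> V"
  shows "linear (\<lambda>u. P x u v)"
  unfolding P_eq
  by (rule linear_compose_sub[OF N_linear_direction[OF x J_smooth]
        linear_compose[OF bilinear_imp_linear(2)[OF \<Gamma>_bil[OF x]] J_linear[OF x], unfolded o_def]])

lemmas P_simps = linear_add[OF linear_P_right] linear_scale[OF linear_P_right]
  linear_neg[OF linear_P_right] linear_diff[OF linear_P_right] linear_0[OF linear_P_right]
  linear_add[OF linear_P_left] linear_scale[OF linear_P_left]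
  linear_neg[OF linear_P_left] linear_diff[OF linear_P_left] linear_0[OF linear_P_left]

text \<open>\<open>nabla_end\<close> is defined by extending a vector to a constant field. The
  Leibniz rule for arbitrary smooth fields shows that this extension was immaterial.\<close>

lemma N_J:
  assumes x: "x \<in> V" and X: "smooth_on V X"
  shows "N s (\<lambda>y. J y (X y)) x = P x s (X x) + J x (N s X x)"
proof -
  have "((\<lambda>y. J y (X y)) has_derivative
      (\<lambda>u. frechet_derivative (\<lambda>y. J y (X x)) (at x) u + J x (frechet_derivative X (at x) u))) (at x)"
    by (rule has_derivative_linear_apply[of V x J X, OF open_V x J_linear
          smooth_on_imp_differentiable[OF J_smooth x] smooth_on_differentiable[OF X x]])
  then show ?thesis
    by (simp add: P_eq nabla_def frechet_derivative_eqI J_simps[OF x])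
qed

lemma nabla_end_pointwise: "nabla_end \<Gamma> X B x v = nabla_end \<Gamma> (\<lambda>_. X x) B x v"
  by (simp add: nabla_end_def nabla_def)

lemma A_eq: "A x s u v = N s (\<lambda>y. P y u v) x - P x u (\<Gamma> x s v) - P x (\<Gamma> x s u) v"
proof -
  have "nabla_end \<Gamma> (nabla \<Gamma> (\<lambda>_. s) (\<lambda>_. u)) J x v = P x (\<Gamma> x s u) v"
    by (subst nabla_end_pointwise) (simp only: N_const)
  then show ?thesis
    unfolding nabla2_end_def by (simp add: nabla_end_def[of \<Gamma> "\<lambda>_. s" "nabla_end \<Gamma> (\<lambda>_. u) J"] N_const)
qed

text \<open>Leibniz rule for the covariant derivative of \<open>J\<close>. The term with
  \<open>\<Gamma> x s u\<close> appears because \<open>u\<close> is constant in the chart and not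
  parallel.\<close>

lemma N_P:
  assumes x: "x \<in> V" and X: "smooth_on V X"
  shows "N s (\<lambda>y. P y u (X y)) x = A x s u (X x) + P x (\<Gamma> x s u) (X x) + P x u (N s X x)"
proof -
  have "((\<lambda>y. P y u (X y)) has_derivative
      (\<lambda>w. frechet_derivative (\<lambda>y. P y u (X x)) (at x) w + P x u (frechet_derivative X (at x) w))) (at x)"
    by (rule has_derivative_linear_apply[of V x "\<lambda>y. P y u" X, OF open_V x linear_P_right
          smooth_on_imp_differentiable[OF smooth_on_P x] smooth_on_differentiable[OF X x]])
  then show ?thesis
    unfolding A_eq by (simp add: nabla_def frechet_derivative_eqI P_simps[OF x])
qed

lemma N_P_const:
  "x \<in> V \<Longrightarrow> N s (\<lambda>y. P y u v) x = A x s u v + P x (\<Gamma> x s u) v + P x u (\<Gamma> x s v)"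
  using N_P[of x "\<lambda>_. v" s u] by (simp add: smooth_on_const[OF open_V] N_const)

lemma linear_A_left: "x \<in> V \<Longrightarrow> linear (\<lambda>s. A x s u v)"
  unfolding A_eq
  by (intro linear_compose_sub N_linear_direction smooth_on_P
      linear_compose[OF bilinear_imp_linear(2)[OF \<Gamma>_bil] linear_P_right, unfolded o_def]
      linear_compose[OF bilinear_imp_linear(2)[OF \<Gamma>_bil] linear_P_left, unfolded o_def])

lemma linear_A_middle:
  assumes x: "x \<in> V"
  shows "linear (\<lambda>u. A x s u v)"
proof (rule linearI)
  fix u w and c :: real
  have "N s (\<lambda>y. P y (u + w) v) x = N s (\<lambda>y. P y u v + P y w v) x"
    by (rule N_cong[OF x]) (simp add: P_simps)
  then show "A x s (u + w) v = A x s u v + A x s w v"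
    by (simp add: A_eq N_add[OF x smooth_on_P smooth_on_P] bilinear_radd[OF \<Gamma>_bil[OF x]] P_simps[OF x])
  have "N s (\<lambda>y. P y (c *\<^sub>R u) v) x = N s (\<lambda>y. c *\<^sub>R P y u v) x"
    by (rule N_cong[OF x]) (simp add: P_simps)
  then show "A x s (c *\<^sub>R u) v = c *\<^sub>R A x s u v"
    by (simp add: A_eq N_scale[OF x smooth_on_P] bilinear_rmul[OF \<Gamma>_bil[OF x]] P_simps[OF x] scaleR_diff_right)
qed

lemma bilinear_A: "x \<in> V \<Longrightarrow> bilinear (\<lambda>s u. A x s u v)"
  unfolding bilinear_def using linear_A_left linear_A_middle by blast

text \<open>Covariant derivative of the identity that the square of \<open>J\<close> is minus the
  identity.\<close>

lemma P_J:
  assumes x: "x \<in> V"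
  shows "P x u (J x v) = - J x (P x u v)"
proof -
  have "N u (\<lambda>y. J y (J y v)) x = N u (\<lambda>_. - v) x"
    by (rule N_cong[OF x JJ])
  then have "P x u (J x v) + J x (P x u v + J x (\<Gamma> x u v)) = - \<Gamma> x u v"
    by (simp add: N_J[OF x J_smooth] N_J[OF x smooth_on_const[OF open_V]] N_const bilinear_rneg[OF \<Gamma>_bil[OF x]])
  then show ?thesis by (simp add: J_simps[OF x] JJ[OF x] eq_neg_iff_add_eq_0)
qed

text \<open>Differentiating the anticommutation of \<open>J\<close> with its derivative once more.
  The two quadratic terms come from the derivative falling on \<open>J\<close> on either side; the
  Christoffel terms cancel.\<close>

lemma A_J:
  assumes x: "x \<in> V"
  shows "A x s u (J x v) = - J x (A x s u v) - P x u (P x s v) - P x s (P x u v)"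
proof -
  have NJ: "N s (\<lambda>y. J y v) x = P x s v + J x (\<Gamma> x s v)"
    using N_J[OF x smooth_on_const[OF open_V], of s v] by (simp add: N_const)
  have "N s (\<lambda>y. P y u (J y v)) x = N s (\<lambda>y. - J y (P y u v)) x"
    by (rule N_cong[OF x P_J])
  also have "\<dots> = - N s (\<lambda>y. J y (P y u v)) x"
    by (rule N_uminus[OF x smooth_on_J_apply[OF smooth_on_P]])
  finally show ?thesis
    by (simp add: N_J[OF x smooth_on_P] N_P[OF x J_smooth] NJ N_P_const[OF x] J_simps[OF x] P_simps[OF x] P_J[OF x] algebra_simps)
qed

lemma J_skew:
  assumes x: "x \<in> V"
  shows "g x (J x v) w = - g x v (J x w)"
  using gJ[OF x, of v "J x w"] by (simp add: JJ[OF x] bilinear_rneg[OF g_bil[OF x]])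

lemma deriv_kaehler:
  assumes x: "x \<in> V"
  shows "frechet_derivative (\<lambda>y. g y (J y v) w) (at x) u
    = g x (P x u v) w + g x (J x (\<Gamma> x u v)) w + g x (J x v) (\<Gamma> x u w)"
  using \<Gamma>_compat[OF x J_smooth smooth_on_const[OF open_V], of v w u]
    N_J[OF x smooth_on_const[OF open_V], of u v]
  by (simp add: N_const bilinear_ladd[OF g_bil[OF x]])

lemma deriv_P:
  assumes x: "x \<in> V"
  shows "frechet_derivative (\<lambda>y. g y (P y u v) w) (at x) s
    = g x (A x s u v) w + g x (P x (\<Gamma> x s u) v) w + g x (P x u (\<Gamma> x s v)) w + g x (P x u v) (\<Gamma> x s w)"
  using \<Gamma>_compat[OF x smooth_on_P smooth_on_const[OF open_V], of u v w s]
  by (simp add: N_const N_P_const[OF x] bilinear_ladd[OF g_bil[OF x]])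

lemma kaehler_smooth: "smooth_on V (\<lambda>y. g y (J y v) w)"
  by (rule smooth_on_metric[OF J_smooth smooth_on_const[OF open_V]])

lemma P_smooth: "smooth_on V (\<lambda>y. g y (P y u v) w)"
  by (rule smooth_on_metric[OF smooth_on_P smooth_on_const[OF open_V]])

lemma kaehler_skew: "x \<in> V \<Longrightarrow> g x (J x v) w = - g x (J x w) v"
  using J_skew[of x v w] g_sym[of x v "J x w"] by simp

lemma deriv_uminus:
  assumes "x \<in> V" "smooth_on V f"
  shows "frechet_derivative (\<lambda>y. - f y) (at x) s = - frechet_derivative f (at x) s"
  by (simp add: frechet_derivative_eqI[OF has_derivative_minus[OF smooth_on_differentiable[OF assms(2,1)]]])

text \<open>Differentiating the skew-symmetry of the Kaehler form; its Christoffel terms are skew by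
  the same symmetry and drop out.\<close>

lemma P_skew:
  assumes x: "x \<in> V"
  shows "g x (P x u v) w = - g x (P x u w) v"
proof -
  have "frechet_derivative (\<lambda>y. g y (J y v) w) (at x) u = frechet_derivative (\<lambda>y. - g y (J y w) v) (at x) u"
    by (rule fun_cong[OF frechet_derivative_cong[OF open_V x]]) (rule kaehler_skew)
  also have "\<dots> = - frechet_derivative (\<lambda>y. g y (J y w) v) (at x) u"
    by (rule deriv_uminus[OF x kaehler_smooth])
  finally show ?thesis
    using kaehler_skew[OF x, of "\<Gamma> x u v" w] kaehler_skew[OF x, of "\<Gamma> x u w" v]
    by (simp add: deriv_kaehler[OF x])
qed

text \<open>As the metric is parallel, the covariant derivative of the Kaehler form is that of
  \<open>J\<close> with an index lowered. This links the codifferential to the divergence of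
  \<open>J\<close>.\<close>

lemma nabla_form_kaehler:
  assumes x: "x \<in> V"
  shows "nabla_form \<Gamma> (\<lambda>_. u) (\<lambda>y v w. g y (J y v) w) x v w = g x (P x u v) w"
  by (simp add: nabla_form_def deriv_kaehler[OF x] N_const)

lemma orthonormal_basis_J:
  assumes x: "x \<in> V" and B: "orthonormal_basis (g x) B"
  shows "orthonormal_basis (g x) (J x ` B)" "inj_on (J x) B"
proof -
  show inj: "inj_on (J x) B"
    by (rule inj_on_inverseI[of _ "\<lambda>v. - J x v"]) (simp add: JJ[OF x])
  then show "orthonormal_basis (g x) (J x ` B)"
    using B unfolding orthonormal_basis_def by (auto simp: card_image gJ[OF x] inj_on_eq_iff)
qed

end

section \<open>Harmonicity of nearly Kaehler structures\<close>

locale nearly_kaehler_chart = hermitian_chart +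
  assumes nk: "x \<in> V \<Longrightarrow> P x v v = 0"
begin

lemma P_swap:
  assumes x: "x \<in> V"
  shows "P x u v = - P x v u"
  using nk[OF x, of "u + v"] by (simp add: P_simps[OF x] nk[OF x] eq_neg_iff_add_eq_0)

lemma A_swap:
  assumes x: "x \<in> V"
  shows "A x s u v = - A x s v u"
proof -
  have "N s (\<lambda>y. P y u v) x = N s (\<lambda>y. - P y v u) x"
    by (rule N_cong[OF x P_swap])
  also have "\<dots> = - N s (\<lambda>y. P y v u) x"
    by (rule N_uminus[OF x smooth_on_P])
  finally show ?thesis
    using P_swap[OF x, of "\<Gamma> x s u" v] P_swap[OF x, of u "\<Gamma> x s v"]
    by (simp add: N_P_const[OF x] algebra_simps)
qed

text \<open>The form on the left is alternating, so its cyclic sum is three times itself. In the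
  cyclic sum of the derivatives of the Kaehler form the Christoffel terms cancel, since \<Gamma> is
  symmetric and the form skew.\<close>

lemma three_P:
  assumes x: "x \<in> V"
  shows "3 * g x (P x u v) w = frechet_derivative (\<lambda>y. g y (J y v) w) (at x) u
    + frechet_derivative (\<lambda>y. g y (J y w) u) (at x) v + frechet_derivative (\<lambda>y. g y (J y u) v) (at x) w"
proof -
  have neg: "g x (- a) b = - g x a b" for a b by (rule bilinear_lneg[OF g_bil[OF x]])
  have "g x (P x v w) u = g x (P x u v) w" "g x (P x w u) v = g x (P x u v) w"
    using P_swap[OF x] P_skew[OF x] neg by metis+
  moreover have "g x (J x (\<Gamma> x a b)) c = - g x (J x c) (\<Gamma> x b a)" for a b c
    using kaehler_skew[OF x, of "\<Gamma> x a b" c] \<Gamma>_sym[OF x, of a b] by simp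
  ultimately show ?thesis by (simp add: deriv_kaehler[OF x])
qed

lemma three_deriv_P:
  assumes x: "x \<in> V"
  shows "3 * frechet_derivative (\<lambda>y. g y (P y u v) w) (at x) s
    = frechet_derivative (\<lambda>y. frechet_derivative (\<lambda>y. g y (J y v) w) (at y) u) (at x) s
    + frechet_derivative (\<lambda>y. frechet_derivative (\<lambda>y. g y (J y w) u) (at y) v) (at x) s
    + frechet_derivative (\<lambda>y. frechet_derivative (\<lambda>y. g y (J y u) v) (at y) w) (at x) s"
proof -
  have D: "((\<lambda>y. frechet_derivative (\<lambda>y. g y (J y v) w) (at y) u) has_derivative
      frechet_derivative (\<lambda>y. frechet_derivative (\<lambda>y. g y (J y v) w) (at y) u) (at x)) (at x)" for u v w
    by (rule smooth_on_differentiable[OF smooth_on_frechet_derivative[OF kaehler_smooth] x])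
  have "((\<lambda>y. 3 * g y (P y u v) w) has_derivative (\<lambda>s. 3 * frechet_derivative (\<lambda>y. g y (P y u v) w) (at x) s)) (at x)"
    by (rule has_derivative_mult_right[OF smooth_on_differentiable[OF P_smooth x]])
  from frechet_derivative_eqI[OF this]
  have "3 * frechet_derivative (\<lambda>y. g y (P y u v) w) (at x) s = frechet_derivative (\<lambda>y. 3 * g y (P y u v) w) (at x) s"
    by simp
  also have "\<dots> = frechet_derivative (\<lambda>y. frechet_derivative (\<lambda>y. g y (J y v) w) (at y) u
    + frechet_derivative (\<lambda>y. g y (J y w) u) (at y) v + frechet_derivative (\<lambda>y. g y (J y u) v) (at y) w) (at x) s"
    by (rule arg_cong[of _ _ "\<lambda>D. D s"], rule frechet_derivative_cong[OF open_V x three_P])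
  also have "\<dots> = frechet_derivative (\<lambda>y. frechet_derivative (\<lambda>y. g y (J y v) w) (at y) u) (at x) s
    + frechet_derivative (\<lambda>y. frechet_derivative (\<lambda>y. g y (J y w) u) (at y) v) (at x) s
    + frechet_derivative (\<lambda>y. frechet_derivative (\<lambda>y. g y (J y u) v) (at y) w) (at x) s"
    using frechet_derivative_eqI[OF has_derivative_add[OF has_derivative_add[OF D[of v w u] D[of w u v]] D[of u v w]]] by simp
  finally show ?thesis .
qed

text \<open>Closedness of the alternating form, evaluated on constant fields: by
  \<open>three_deriv_P\<close> this is an instance of the vanishing of the square of the exterior
  derivative.\<close>

lemma deriv_P_alternation:
  assumes x: "x \<in> V"
  shows "frechet_derivative (\<lambda>y. g y (P y u v) w) (at x) s - frechet_derivative (\<lambda>y. g y (P y s v) w) (at x) u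
    + frechet_derivative (\<lambda>y. g y (P y s u) w) (at x) v - frechet_derivative (\<lambda>y. g y (P y s u) v) (at x) w = 0"
proof -
  define H where "H a b c d = frechet_derivative (\<lambda>y. frechet_derivative (\<lambda>y. g y (J y c) d) (at y) b) (at x) a" for a b c d
  have sym: "H a b c d = H b a c d" for a b c d
    unfolding H_def by (rule frechet_derivative_symmetric[OF open_V x kaehler_smooth])
  have skew: "H a b c d = - H a b d c" for a b c d
  proof -
    have "frechet_derivative (\<lambda>y. g y (J y c) d) (at y) b = - frechet_derivative (\<lambda>y. g y (J y d) c) (at y) b"
      if y: "y \<in> V" for y
    proof -
      have "frechet_derivative (\<lambda>y. g y (J y c) d) (at y) b = frechet_derivative (\<lambda>y. - g y (J y d) c) (at y) b"
        by (rule fun_cong[OF frechet_derivative_cong[OF open_V y]]) (rule kaehler_skew)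
      also have "\<dots> = - frechet_derivative (\<lambda>y. g y (J y d) c) (at y) b"
        by (rule deriv_uminus[OF y kaehler_smooth])
      finally show ?thesis .
    qed
    then have "H a b c d = frechet_derivative (\<lambda>y. - frechet_derivative (\<lambda>y. g y (J y d) c) (at y) b) (at x) a"
      unfolding H_def by (intro fun_cong[OF frechet_derivative_cong[OF open_V x]])
    also have "\<dots> = - H a b d c"
      unfolding H_def by (rule deriv_uminus[OF x smooth_on_frechet_derivative[OF kaehler_smooth]])
    finally show ?thesis .
  qed
  \<comment> \<open>Expanding the four derivatives gives twelve values of \<open>H\<close>, which
    cancel in six pairs by \<open>sym\<close> and \<open>skew\<close>.\<close>
  note t = three_deriv_P[OF x, folded H_def]
  show ?thesis
    using t[of u v w s] t[of s v w u] t[of s u w v] t[of s u v w]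
      sym[of s u v w] sym[of s v w u] skew[of v s w u] sym[of s w u v] sym[of u v w s] sym[of u w s v] skew[of w u s v]
      sym[of v w s u]
    by linarith
qed

text \<open>Closedness expressed by covariant derivatives. The Christoffel corrections of
  \<open>deriv_P\<close> cancel because \<Gamma> is symmetric and \<open>\<Psi>\<close>
  alternating.\<close>

lemma A_alternation:
  assumes x: "x \<in> V"
  shows "g x (A x s u v) w - g x (A x u s v) w + g x (A x v s u) w - g x (A x w s u) v = 0"
proof -
  define \<Psi> where "\<Psi> a b c = g x (P x a b) c" for a b c
  have neg: "g x (- a) b = - g x a b" for a b by (rule bilinear_lneg[OF g_bil[OF x]])
  have sw: "\<Psi> a b c = - \<Psi> b a c" "\<Psi> a b c = - \<Psi> a c b" for a b c
    unfolding \<Psi>_def using P_swap[OF x, of a b] P_skew[OF x, of a b c] by (simp_all add: neg)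
  note d = deriv_P[OF x, folded \<Psi>_def]
  show ?thesis
    using deriv_P_alternation[OF x, of u v w s] \<Gamma>_sym[OF x, of u s] \<Gamma>_sym[OF x, of v s] \<Gamma>_sym[OF x, of w s]
      \<Gamma>_sym[OF x, of v u] \<Gamma>_sym[OF x, of w u] \<Gamma>_sym[OF x, of w v]
      sw(1)[of u "\<Gamma> x s v" w] sw(1)[of "\<Gamma> x s w" u v] sw(2)[of u "\<Gamma> x s w" v] sw(2)[of s "\<Gamma> x u w" v]
    by (simp only: d)
qed

lemma nearly_kaehler_harmonic:
  assumes x: "x \<in> V" and B: "orthonormal_basis (g x) B"
  shows "(\<Sum>b\<in>B. A x b b (J x v)) = J x (\<Sum>b\<in>B. A x b b v)"
proof -
  interpret inner_form "g x" by (rule inner[OF x])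
  have self_neg: "w = 0" if "w = - w" for w :: 'a
  proof -
    have "2 *\<^sub>R w = 0" unfolding scaleR_2 using that by (simp only: eq_neg_iff_add_eq_0)
    then show ?thesis by simp
  qed
  \<comment> \<open>The square of the derivative of \<open>J\<close> in the direction
    \<open>b\<close>; it is self-adjoint because that derivative is skew.\<close>
  define S where "S b v = P x b (P x b v)" for b v
  have S_sym: "g x (S b y) z = g x (S b z) y" for b y z
  proof -
    have "g x (S b y) z = - g x (P x b z) (P x b y)"
      unfolding S_def by (rule P_skew[OF x])
    also have "\<dots> = - g x (P x b y) (P x b z)" by (simp add: sym)
    also have "\<dots> = g x (S b z) y" unfolding S_def by (simp add: P_skew[OF x, of b "P x b z"])
    finally show ?thesis .
  qed
  have PP: "P x y (P x b b) = 0" "P x b (P x y b) = - S b y" for b y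
    unfolding S_def using P_swap[OF x, of y b] by (simp_all add: nk[OF x] P_simps[OF x])
  have Abb: "A x b b (J x y) = - J x (A x b b y) - 2 *\<^sub>R S b y" for b y
    using A_J[OF x, of b b y] by (simp add: S_def scaleR_2)
  \<comment> \<open>Replacing the second direction \<open>b\<close> by \<open>J x b\<close> relates
    the Laplacian terms to sums that are controlled by closedness.\<close>
  have AbJ: "A x b (J x b) y = A x b b (J x y) + S b y" for b y
  proof -
    have "A x b (J x b) y = - A x b y (J x b)" by (rule A_swap[OF x])
    also have "\<dots> = J x (A x b y b) - S b y"
      using A_J[OF x, of b y b] PP[where b = b and y = y] by simp
    also have "A x b y b = - A x b b y" by (rule A_swap[OF x])
    finally show ?thesis using Abb[of b y] by (simp add: J_simps[OF x] scaleR_2)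
  qed
  have AyJ: "A x y b (J x b) = S b y" for b y
  proof -
    have "A x y b b = 0" by (rule self_neg[OF A_swap[OF x]])
    then show ?thesis using A_J[OF x, of y b b] PP[where b = b and y = y] by (simp add: J_simps[OF x])
  qed
  \<comment> \<open>In the closedness relation for \<open>b\<close>, \<open>J x b\<close>,
    \<open>y\<close>, \<open>z\<close> the last two terms are values of \<open>S b\<close> by
    \<open>AyJ\<close>, and they cancel since \<open>S b\<close> is self-adjoint.\<close>
  have cancel: "g x (A x b (J x b) y) z = g x (A x (J x b) b y) z" for b y z
    using A_alternation[OF x, of b "J x b" y z] S_sym[of b y z] by (simp add: AyJ)
  \<comment> \<open>Since \<open>J x\<close> maps orthonormal bases to orthonormal bases, the sum
    may be taken over the image of \<open>B\<close>; applying \<open>J x\<close> twice produces the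
    sign. Together with \<open>unflip\<close> the sum equals its own negative.\<close>
  have flip: "(\<Sum>b\<in>B. A x (J x b) b y) = - (\<Sum>b\<in>B. A x b (J x b) y)" for y
  proof -
    have bl: "bilinear (\<lambda>s u. A x s (J x u) y)"
      unfolding bilinear_def
      using linear_A_left[OF x] linear_compose[OF J_linear[OF x] linear_A_middle[OF x]] by (auto simp: o_def)
    have "(\<Sum>b\<in>B. A x b (J x b) y) = (\<Sum>b\<in>J x ` B. A x b (J x b) y)"
      by (rule orthonormal_sum_eq[OF B orthonormal_basis_J(1)[OF x B] bl])
    also have "\<dots> = (\<Sum>b\<in>B. A x (J x b) (- b) y)"
      using orthonormal_basis_J(2)[OF x B] by (simp add: sum.reindex JJ[OF x])
    also have "\<dots> = - (\<Sum>b\<in>B. A x (J x b) b y)"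
      by (simp add: linear_neg[OF linear_A_middle[OF x]] sum_negf)
    finally show ?thesis by simp
  qed
  have unflip: "(\<Sum>b\<in>B. A x b (J x b) y) = (\<Sum>b\<in>B. A x (J x b) b y)" for y
    by (rule form_eqI) (simp add: form_sum_left cancel)
  have "(\<Sum>b\<in>B. A x b (J x b) y) = 0" for y
    by (rule self_neg[OF trans[OF unflip flip]])
  then have Q: "(\<Sum>b\<in>B. A x b b (J x v)) = - (\<Sum>b\<in>B. S b v)"
    by (simp add: AbJ sum.distrib eq_neg_iff_add_eq_0)
  moreover have "(\<Sum>b\<in>B. A x b b (J x v)) = - J x (\<Sum>b\<in>B. A x b b v) - 2 *\<^sub>R (\<Sum>b\<in>B. S b v)"
    by (simp add: Abb linear_sum[OF J_linear[OF x]] sum_subtractf sum_negf scaleR_sum_right)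
  ultimately show ?thesis by (simp add: scaleR_2 algebra_simps) (metis minus_minus)
qed

end

section \<open>Warped products\<close>

lemma metric_chart_of_riemannian_metric:
  assumes "smooth_manifold M" "riemannian_metric M g" "i \<in> charts M"
  shows "metric_chart (cimg M i) (g i)"
proof (rule metric_chart.intro)
  show "open (cimg M i)" by (rule smooth_manifold_chartD(2)[OF assms(1,3)])
  show "inner_form (g i x)" if "x \<in> cimg M i" for x
    by standard (use assms(2,3) that in \<open>auto simp: riemannian_metric_def\<close>)
  show "smooth_on (cimg M i) (\<lambda>x. g i x u v)" for u v
    using assms(2,3) by (auto simp: riemannian_metric_def)
qed

section \<open>The fibre and the warped product in a single chart\<close>

locale warped_chart =
  fixes M :: "('i, 'a, 'e::euclidean_space) almost_hermitian" and f :: "real \<Rightarrow> real" and i :: 'i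
  assumes M: "almost_hermitian_manifold M" and f_smooth: "smooth_on UNIV f" and f_pos: "f t > 0"
    and i: "i \<in> charts M"
begin

abbreviation "V \<equiv> cimg M i"
abbreviation "h \<equiv> rmetric M i"
abbreviation "\<Gamma> \<equiv> lc M i"
abbreviation "J \<equiv> cstr M i"
abbreviation "W \<equiv> warped_product f M"

sublocale C: hermitian_chart V h \<Gamma> J
proof -
  have m: "metric_chart V h"
    using M i metric_chart_of_riemannian_metric by (auto simp: almost_hermitian_manifold_def)
  then interpret metric_chart V h .
  show "hermitian_chart V h \<Gamma> J"
  proof (intro hermitian_chart.intro levi_civita_chart.intro hermitian_chart_axioms.intro
      levi_civita_chart_axioms.intro m)
    show "is_levi_civita V h \<Gamma>" unfolding lc_def by (rule is_levi_civita_levi_civita)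
    show "linear (J x)" if "x \<in> V" for x
      using M i that by (auto simp: almost_hermitian_manifold_def smooth_endomorphism_field_def)
    show "smooth_on V (\<lambda>x. J x v)" for v
      using M i by (auto simp: almost_hermitian_manifold_def smooth_endomorphism_field_def)
    show "J x (J x v) = - v" "h x (J x u) (J x v) = h x u v" if "x \<in> V" for x u v
      using M i that by (auto simp: almost_hermitian_manifold_def)
  qed
qed

sublocale W: levi_civita_chart "UNIV \<times> V" "rmetric W i" "lc W i"
proof -
  have "almost_contact_metric_manifold W"
    by (rule almost_contact_metric_manifold_warped_product[OF M f_smooth]) (simp add: f_pos)
  then have "metric_chart (cimg W i) (rmetric W i)"
    using i metric_chart_of_riemannian_metric[of W "rmetric W" i] by (simp add: almost_contact_metric_manifold_def)
  then have m: "metric_chart (UNIV \<times> V) (rmetric W i)" by simp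
  then interpret metric_chart "UNIV \<times> V" "rmetric W i" .
  show "levi_civita_chart (UNIV \<times> V) (rmetric W i) (lc W i)"
    by standard (simp add: lc_def is_levi_civita_levi_civita)
qed

section \<open>The Levi-Civita connection of the warped product\<close>

definition "df t = frechet_derivative f (at t) 1"
definition "q t = df t / f t"

lemma f_nz: "f t \<noteq> 0" using f_pos[of t] by simp

lemma df_smooth: "smooth_on UNIV df"
  unfolding df_def[abs_def] by (rule smooth_on_frechet_derivative[OF f_smooth])

lemma q_smooth: "smooth_on UNIV q"
  unfolding q_def[abs_def] by (rule smooth_on_divide[OF open_UNIV df_smooth f_smooth f_nz])

lemma has_derivative_f: "(f has_derivative (\<lambda>s. s * df t)) (at t)"
proof -
  have d: "(f has_derivative frechet_derivative f (at t)) (at t)"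
    by (rule smooth_on_differentiable[OF f_smooth UNIV_I])
  have "frechet_derivative f (at t) s = s * df t" for s
    using linear_scale[OF has_derivative_linear[OF d], of s 1] by (simp add: df_def)
  then show ?thesis using d by (simp add: ext[of "frechet_derivative f (at t)" "\<lambda>s. s * df t"])
qed

lemma has_derivative_comp_fst:
  "(p has_derivative p') (at t) \<Longrightarrow> ((\<lambda>y. p (fst y)) has_derivative (\<lambda>U. p' (fst U))) (at (t, x))"
  by (rule has_derivative_compose[OF has_derivative_fst[OF has_derivative_ident]]) simp

lemma has_derivative_comp_snd:
  "(p has_derivative p') (at x) \<Longrightarrow> ((\<lambda>y. p (snd y)) has_derivative (\<lambda>U. p' (snd U))) (at (t, x))"
  by (rule has_derivative_compose[OF has_derivative_snd[OF has_derivative_ident]]) simp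

definition G :: "real \<times> 'e \<Rightarrow> real \<times> 'e \<Rightarrow> real \<times> 'e \<Rightarrow> real \<times> 'e" where
  "G y X Y = (- (f (fst y) * df (fst y) * h (snd y) (snd X) (snd Y)),
     \<Gamma> (snd y) (snd X) (snd Y) + q (fst y) *\<^sub>R (fst X *\<^sub>R snd Y + fst Y *\<^sub>R snd X))"

lemma rmetric_W: "rmetric W i y X Y = fst X * fst Y + (f (fst y))\<^sup>2 * h (snd y) (snd X) (snd Y)"
  by (cases y; cases X; cases Y) simp

lemma is_levi_civita_G: "is_levi_civita (UNIV \<times> V) (rmetric W i) G"
proof (rule W.is_levi_civitaI)
  fix y :: "real \<times> 'e" assume "y \<in> UNIV \<times> V"
  then obtain t x where y: "y = (t, x)" and x: "x \<in> V" by auto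
  interpret h: inner_form "h x" by (rule C.inner[OF x])
  note gs = bilinear_ladd[OF C.\<Gamma>_bil[OF x]] bilinear_radd[OF C.\<Gamma>_bil[OF x]]
    bilinear_lmul[OF C.\<Gamma>_bil[OF x]] bilinear_rmul[OF C.\<Gamma>_bil[OF x]]
  show "bilinear (G y)"
    unfolding bilinear_def
    by (intro conjI allI linearI) (simp_all add: G_def y h.form_simps gs algebra_simps)
  show "G y X Y = G y Y X" for X Y
    using C.\<Gamma>_sym[OF x] by (simp add: G_def y h.sym add.commute)
  fix U X Y :: "real \<times> 'e"
  obtain a u b v c w where UXY: "U = (a, u)" "X = (b, v)" "Y = (c, w)" by (metis surj_pair)
  note df = has_derivative_comp_fst[OF has_derivative_f, of t x]
  note dh = has_derivative_comp_snd[OF C.has_derivative_g[OF x, of "snd X" "snd Y"], of t]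
  note has_derivative_add[OF has_derivative_const[of "fst X * fst Y" "at (t, x)"]
      has_derivative_mult[OF has_derivative_mult[OF df df] dh]]
  then have D: "frechet_derivative (\<lambda>y. rmetric W i y X Y) (at y) U
      = (f t)\<^sup>2 * (h x (\<Gamma> x u v) w + h x v (\<Gamma> x u w)) + 2 * f t * a * df t * h x v w"
    unfolding rmetric_W power2_eq_square y
    by (simp add: frechet_derivative_eqI UXY C.levi_civita_compat_const[OF C.lc x] algebra_simps)
  \<comment> \<open>The one relation between \<open>q\<close> and \<open>f\<close> that
    compatibility uses: the terms with \<open>b\<close> and \<open>c\<close> cancel those of the
    first component of \<open>G\<close>, and the term with \<open>a\<close> becomes the derivative
    of the square of \<open>f\<close>.\<close>
  have qf: "f t * (f t * q t) = f t * df t" using f_nz[of t] by (simp add: q_def)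
  show "frechet_derivative (\<lambda>y. rmetric W i y X Y) (at y) U = rmetric W i y (G y U X) Y + rmetric W i y X (G y U Y)"
  proof -
    have "rmetric W i y (G y U X) Y + rmetric W i y X (G y U Y)
      = (f t)\<^sup>2 * (h x (\<Gamma> x u v) w + h x v (\<Gamma> x u w)) + f t * (f t * q t) * (2 * a * h x v w + b * h x u w + c * h x u v)
       - f t * df t * (b * h x u w + c * h x u v)"
      by (simp add: rmetric_W G_def y UXY h.form_simps h.sym[of v u] power2_eq_square algebra_simps)
    also have "\<dots> = (f t)\<^sup>2 * (h x (\<Gamma> x u v) w + h x v (\<Gamma> x u w)) + 2 * f t * a * df t * h x v w"
      unfolding qf by (simp add: algebra_simps)
    finally show ?thesis using D by simp
  qed
next
  fix X Y :: "real \<times> 'e"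
  note o = C.open_V and oW = W.open_V
  show "smooth_on (UNIV \<times> V) (\<lambda>y. G y X Y)"
    unfolding G_def
    by (intro smooth_on_Pair smooth_on_uminus smooth_on_mult smooth_on_add smooth_on_scaleR oW
        smooth_on_fst[OF f_smooth o] smooth_on_fst[OF df_smooth o] smooth_on_fst[OF q_smooth o]
        smooth_on_snd[OF C.smooth_g o] smooth_on_snd[OF C.\<Gamma>_smooth o] smooth_on_const)
qed

text \<open>Since \<open>lc\<close> is obtained by choice, its values are known only through
  uniqueness, here by comparison with \<open>G\<close>.\<close>

lemma lc_W:
  assumes "x \<in> V"
  shows "lc W i (t, x) (a, u) (b, v)
    = (- (f t * df t * h x u v), \<Gamma> x u v + q t *\<^sub>R (a *\<^sub>R v + b *\<^sub>R u))"
  using W.levi_civita_unique[OF W.lc is_levi_civita_G, of "(t, x)" "(a, u)" "(b, v)"] assms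
  by (simp add: G_def)

section \<open>Derivatives of the characteristic field and traces\<close>

lemma projD_W: "x \<in> V \<Longrightarrow> projD W i (t, x) (c, z) = (0, z)"
  by (simp add: projD_def eta_def bilinear_lzero[OF C.g_bil])

lemma nabla_xi:
  assumes x: "x \<in> V"
  shows "nabla (lc W i) X (xi W i) (t, x) = (0, q t *\<^sub>R snd (X (t, x)))"
proof -
  have "xi W i = (\<lambda>_. (1, 0))" by (simp add: fun_eq_iff)
  moreover obtain a u where "X (t, x) = (a, u)" by fastforce
  ultimately show ?thesis
    by (simp add: nabla_def frechet_derivative_const lc_W[OF x] bilinear_rzero[OF C.g_bil[OF x]] bilinear_rzero[OF C.\<Gamma>_bil[OF x]])
qed

text \<open>The terms with \<Gamma> cancel. What remains in the second component pairs the first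
  component of one argument with the fibre part of the other, so it contributes nothing to the
  trace.\<close>

lemma nabla2_xi:
  assumes x: "x \<in> V"
  shows "nabla2 (lc W i) (\<lambda>_. (a, u)) (\<lambda>_. (b, v)) (xi W i) (t, x)
    = (- (f t * df t * q t * h x u v), (a * frechet_derivative q (at t) 1) *\<^sub>R v - ((q t)\<^sup>2 * b) *\<^sub>R u)"
proof -
  have tx: "(t, x) \<in> UNIV \<times> V" using x by simp
  have dq: "(q has_derivative frechet_derivative q (at t)) (at t)"
    by (rule smooth_on_differentiable[OF q_smooth UNIV_I])
  have dqa: "frechet_derivative q (at t) a = a * frechet_derivative q (at t) 1"
    using linear_scale[OF has_derivative_linear[OF dq], of a 1] by simp
  have "((\<lambda>y. (0 :: real, q (fst y) *\<^sub>R v)) has_derivative (\<lambda>U. (0, frechet_derivative q (at t) (fst U) *\<^sub>R v))) (at (t, x))"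
    by (intro has_derivative_Pair has_derivative_const has_derivative_scaleR_left has_derivative_comp_fst dq)
  then have d: "frechet_derivative (\<lambda>y. (0 :: real, q (fst y) *\<^sub>R v)) (at (t, x)) (a, u)
      = (0, (a * frechet_derivative q (at t) 1) *\<^sub>R v)"
    by (simp add: frechet_derivative_eqI dqa)
  have "W.N (a, u) (nabla (lc W i) (\<lambda>_. (b, v)) (xi W i)) (t, x) = W.N (a, u) (\<lambda>y. (0, q (fst y) *\<^sub>R v)) (t, x)"
    by (rule W.N_cong[OF tx]) (auto simp: nabla_xi)
  then show ?thesis
    by (simp add: nabla2_def nabla_xi[OF x] W.N_const lc_W[OF x])
      (simp add: nabla_def d lc_W[OF x] bilinear_rmul[OF C.g_bil[OF x]] bilinear_rmul[OF C.\<Gamma>_bil[OF x]]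
        algebra_simps power2_eq_square)
qed

lemma warped_orthonormal_basis:
  assumes x: "x \<in> V" and B: "orthonormal_basis (h x) B"
  shows "orthonormal_basis (rmetric W i (t, x)) (insert (1, 0) ((\<lambda>b. (0, (1 / f t) *\<^sub>R b)) ` B))"
proof -
  interpret h: inner_form "h x" by (rule C.inner[OF x])
  note fin = h.orthonormal_finite[OF B]
  have "card ((\<lambda>b. (0 :: real, (1 / f t) *\<^sub>R b)) ` B) = DIM('e)"
    using B f_nz[of t] by (subst card_image) (auto simp: inj_on_def orthonormal_basis_def)
  moreover have "(1, 0) \<notin> (\<lambda>b. (0 :: real, (1 / f t) *\<^sub>R b)) ` B" by auto
  ultimately have "card (insert (1, 0) ((\<lambda>b. (0 :: real, (1 / f t) *\<^sub>R b)) ` B)) = DIM(real \<times> 'e)"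
    using fin by simp
  moreover have "rmetric W i (t, x) X Y = (if X = Y then 1 else 0)"
    if "X \<in> insert (1, 0) ((\<lambda>b. (0, (1 / f t) *\<^sub>R b)) ` B)" "Y \<in> insert (1, 0) ((\<lambda>b. (0, (1 / f t) *\<^sub>R b)) ` B)" for X Y
    using that B f_nz[of t]
    by (auto simp: orthonormal_basis_def h.form_simps power2_eq_square split: if_splits) metis
  ultimately show ?thesis unfolding orthonormal_basis_def by blast
qed

text \<open>An orthonormal basis consists of the unit vector along the line and the fibre basis
  scaled by \<open>1 / f t\<close>; bilinearity squares this factor.\<close>

lemma warped_trace:
  fixes T :: "real \<times> 'e \<Rightarrow> real \<times> 'e \<Rightarrow> 'b::real_vector"
  assumes x: "x \<in> V" and B: "orthonormal_basis (h x) B" and T: "bilinear T"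
  shows "metric_trace (rmetric W i (t, x)) T
    = T (1, 0) (1, 0) + (1 / (f t)\<^sup>2) *\<^sub>R (\<Sum>b\<in>B. T (0, b) (0, b))"
proof -
  interpret h: inner_form "h x" by (rule C.inner[OF x])
  interpret k: inner_form "rmetric W i (t, x)" by (rule W.inner) (use x in simp)
  note fin = h.orthonormal_finite[OF B]
  have inj: "inj_on (\<lambda>b. (0 :: real, (1 / f t) *\<^sub>R b)) B"
    using f_nz[of t] by (auto simp: inj_on_def)
  have scale: "T (0, c *\<^sub>R b) (0, c *\<^sub>R b) = (c * c) *\<^sub>R T (0, b) (0, b)" for c b
    using bilinear_lmul[OF T, of c "(0, b)"] bilinear_rmul[OF T, of _ c "(0, b)"] by simp
  have "metric_trace (rmetric W i (t, x)) T
      = T (1, 0) (1, 0) + (\<Sum>Y\<in>(\<lambda>b. (0, (1 / f t) *\<^sub>R b)) ` B. T Y Y)"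
    unfolding k.metric_trace_eq[OF warped_orthonormal_basis[OF x B] T]
    using fin by (subst sum.insert) auto
  also have "(\<Sum>Y\<in>(\<lambda>b. (0, (1 / f t) *\<^sub>R b)) ` B. T Y Y) = (1 / (f t)\<^sup>2) *\<^sub>R (\<Sum>b\<in>B. T (0, b) (0, b))"
    unfolding sum.reindex[OF inj] o_def scale by (simp add: scaleR_sum_right power2_eq_square)
  finally show ?thesis .
qed

lemma tau_xi_W:
  assumes x: "x \<in> V"
  shows "tau_xi W i (t, x) = 0"
proof -
  interpret h: inner_form "h x" by (rule C.inner[OF x])
  obtain B where B: "orthonormal_basis (h x) B" using C.orthonormal_basis_exists[OF x] by (elim exE)
  have hB: "(\<Sum>b\<in>B. h x b b) = real DIM('e)"
    using B by (simp add: orthonormal_basis_def)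
  \<comment> \<open>The summand is written explicitly in terms of the two tangent vectors, so that
    the bilinearity required by \<open>warped_trace\<close> can be checked.\<close>
  let ?T = "\<lambda>X Y. (- (f t * df t * q t * h x (snd X) (snd Y)),
      (fst X * frechet_derivative q (at t) 1) *\<^sub>R snd Y - ((q t)\<^sup>2 * fst Y) *\<^sub>R snd X)"
  have "bilinear ?T"
    unfolding bilinear_def by (intro conjI allI linearI) (simp_all add: h.form_simps algebra_simps)
  moreover have "nabla2 (lc W i) (\<lambda>_. X) (\<lambda>_. Y) (xi W i) (t, x) = ?T X Y" for X Y
    using nabla2_xi[OF x, of "fst X" "snd X" "fst Y" "snd Y" t] by simp
  ultimately have "rough_laplacian_xi W i (t, x) = - (1 / (f t)\<^sup>2) *\<^sub>R (\<Sum>b\<in>B. (- (f t * df t * q t * h x b b), 0))"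
    by (simp add: rough_laplacian_xi_def warped_trace[OF x B] h.form_simps zero_prod_def)
  also have "(\<Sum>b\<in>B. (- (f t * df t * q t * h x b b), 0 :: 'e)) = (- (f t * df t * q t * real DIM('e)), 0)"
    unfolding hB[symmetric] sum_distrib_left
    using h.orthonormal_finite[OF B] by (simp add: sum_prod sum_negf)
  \<comment> \<open>After division by the square of \<open>f t\<close>, the factor
    \<open>f t * df t * q t\<close> becomes the square of \<open>q t\<close>, which is also the
    value per dimension of the squared norm computed next.\<close>
  finally have L: "rough_laplacian_xi W i (t, x) = ((q t)\<^sup>2 * real DIM('e), 0)"
    using f_nz[of t] by (simp add: q_def power2_eq_square)
  let ?S = "\<lambda>X Y. (f t)\<^sup>2 * (q t * (q t * h x (snd X) (snd Y)))"
  have bl: "bilinear ?S"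
    unfolding bilinear_def by (intro conjI allI linearI) (simp_all add: h.form_simps algebra_simps)
  have eq: "rmetric W i (t, x) (nabla (lc W i) (\<lambda>_. X) (xi W i) (t, x)) (nabla (lc W i) (\<lambda>_. Y) (xi W i) (t, x)) = ?S X Y" for X Y
    by (simp add: nabla_xi[OF x] h.form_simps)
  have "norm2_nabla_xi W i (t, x) = (q t)\<^sup>2 * real DIM('e)"
    unfolding norm2_nabla_xi_def eq warped_trace[OF x B bl] hB[symmetric]
    using f_nz[of t] by (simp add: h.form_simps power2_eq_square sum_distrib_left[symmetric])
  then show ?thesis
    unfolding tau_xi_def L by simp
qed

section \<open>Derivatives of the almost complex structure on the warped product\<close>

text \<open>For a field that does not depend on \<open>t\<close>, the warping adds only a multiple
  of the identity to the connection in the fibre, which commutes with \<open>a x\<close>, and a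
  component along \<xi>, which the projection removes. Hence the fibre derivative alone
  remains.\<close>

lemma nablaD_end_W:
  assumes x: "x \<in> V" and lin: "\<And>y. y \<in> V \<Longrightarrow> linear (a y)" and smooth: "smooth_on V (\<lambda>y. a y w)"
    and A: "\<And>s y c w. y \<in> V \<Longrightarrow> A (s, y) (c, w) = (0, a y w)"
  shows "nablaD_end W i X A (t, x) (c, w) = (0, nabla_end \<Gamma> (\<lambda>_. snd (X (t, x))) a x w)"
proof -
  obtain \<alpha> u where Xtx: "X (t, x) = (\<alpha>, u)" by fastforce
  have tx: "(t, x) \<in> UNIV \<times> V" using x by simp
  have "((\<lambda>y. (0 :: real, a (snd y) w)) has_derivative (\<lambda>U. (0, frechet_derivative (\<lambda>y. a y w) (at x) (snd U)))) (at (t, x))"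
    by (intro has_derivative_Pair has_derivative_const has_derivative_comp_snd smooth_on_differentiable[OF smooth x])
  then have d: "frechet_derivative (\<lambda>y. A y (projD W i y (c, w))) (at (t, x)) (\<alpha>, u)
      = (0, frechet_derivative (\<lambda>y. a y w) (at x) u)"
    using frechet_derivative_cong[OF W.open_V tx, of "\<lambda>y. A y (projD W i y (c, w))" "\<lambda>y. (0, a (snd y) w)"]
    by (auto simp: frechet_derivative_eqI projD_W A)
  have e: "frechet_derivative (\<lambda>y. projD W i y (c, w)) (at (t, x)) = (\<lambda>_. 0)"
    using frechet_derivative_cong[OF W.open_V tx, of "\<lambda>y. projD W i y (c, w)" "\<lambda>y. (0, w)"]
    by (auto simp: frechet_derivative_const projD_W)
  show ?thesis
    by (simp add: nablaD_end_def nablaD_def nabla_def Xtx d e projD_W[OF x] A[OF x] lc_W[OF x] nabla_end_def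
        frechet_derivative_const linear_add[OF lin[OF x]] linear_scale[OF lin[OF x]])
qed

lemma nablaD_end_phi:
  assumes "x \<in> V"
  shows "nablaD_end W i X (phi W i) (t, x) (c, w) = (0, C.P x (snd (X (t, x))) w)"
  by (rule nablaD_end_W[OF assms C.J_linear C.J_smooth]) simp_all

text \<open>The iterated derivative is that of the fibre by two uses of \<open>nablaD_end_W\<close>.
  The term with \<open>q\<close> comes from the mixed part of the derivative of one constant field
  along another.\<close>

lemma nablaD2_end_phi:
  assumes x: "x \<in> V"
  shows "nablaD2_end W i (\<lambda>_. X) (\<lambda>_. Y) (phi W i) (t, x) (c, z)
    = (0, C.A x (snd X) (snd Y) z - q t *\<^sub>R C.P x (fst X *\<^sub>R snd Y + fst Y *\<^sub>R snd X) z)"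
proof -
  have "nablaD_end W i (\<lambda>_. X) (nablaD_end W i (\<lambda>_. Y) (phi W i)) (t, x) (c, z)
      = (0, nabla_end \<Gamma> (\<lambda>_. snd X) (nabla_end \<Gamma> (\<lambda>_. snd Y) J) x z)"
    by (rule nablaD_end_W[OF x C.linear_P_right C.smooth_on_P]) (simp_all add: nablaD_end_phi)
  moreover have "nabla (lc W i) (\<lambda>_. X) (\<lambda>_. Y) (t, x)
      = (- (f t * df t * h x (snd X) (snd Y)), \<Gamma> x (snd X) (snd Y) + q t *\<^sub>R (fst X *\<^sub>R snd Y + fst Y *\<^sub>R snd X))"
    using lc_W[OF x, of t "fst X" "snd X" "fst Y" "snd Y"] by (simp add: W.N_const)
  moreover have "C.A x (snd X) (snd Y) z = nabla_end \<Gamma> (\<lambda>_. snd X) (nabla_end \<Gamma> (\<lambda>_. snd Y) J) x z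
      - C.P x (\<Gamma> x (snd X) (snd Y)) z"
    unfolding nabla2_end_def C.nabla_end_pointwise[of "nabla _ _ _"] C.N_const ..
  ultimately show ?thesis
    by (simp add: nablaD2_end_def nablaD_end_phi[OF x] C.P_simps[OF x] algebra_simps)
qed

text \<open>The derivative of \<xi> is \<open>q t\<close> times the fibre part, so the direction of
  \<xi> contributes nothing and the fibre directions give the divergence of
  \<open>J\<close>.\<close>

lemma T_phi_W:
  assumes x: "x \<in> V" and B: "orthonormal_basis (h x) B"
  shows "T_phi W i (t, x) = (q t / (f t)\<^sup>2) *\<^sub>R (\<Sum>b\<in>B. (0, C.P x b b))"
proof -
  let ?T = "\<lambda>X Y. (0 :: real, C.P x (snd X) (q t *\<^sub>R snd Y))"
  have bl: "bilinear ?T"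
    unfolding bilinear_def by (intro conjI allI linearI) (simp_all add: C.P_simps[OF x] algebra_simps)
  have eq: "nablaD_end W i (\<lambda>_. X) (phi W i) (t, x) (nabla (lc W i) (\<lambda>_. Y) (xi W i) (t, x)) = ?T X Y" for X Y
    by (simp add: nabla_xi[OF x] nablaD_end_phi[OF x])
  have "T_phi W i (t, x) = (1 / (f t)\<^sup>2) *\<^sub>R (\<Sum>b\<in>B. (0, C.P x b (q t *\<^sub>R b)))"
    unfolding T_phi_def eq warped_trace[OF x B bl] by (simp add: C.P_simps[OF x] zero_prod_def)
  also have "(\<Sum>b\<in>B. (0 :: real, C.P x b (q t *\<^sub>R b))) = q t *\<^sub>R (\<Sum>b\<in>B. (0, C.P x b b))"
    unfolding scaleR_sum_right by (rule sum.cong) (simp_all add: C.P_simps[OF x])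
  finally show ?thesis by simp
qed

lemma rough_laplacian_cstr_eq:
  assumes x: "x \<in> V" and B: "orthonormal_basis (h x) B"
  shows "rough_laplacian_cstr M i x z = - (\<Sum>b\<in>B. C.A x b b z)"
proof -
  interpret h: inner_form "h x" by (rule C.inner[OF x])
  show ?thesis
    unfolding rough_laplacian_cstr_def by (simp only: h.metric_trace_eq[OF B C.bilinear_A[OF x]])
qed

text \<open>The term with \<open>q\<close> is mixed: on each basis vector either the first component
  or the fibre part is zero, so it disappears from the trace.\<close>

lemma rough_laplacian_J_W:
  assumes x: "x \<in> V"
  shows "rough_laplacian_J W i (t, x) (c, z) = (0, (1 / (f t)\<^sup>2) *\<^sub>R rough_laplacian_cstr M i x z)"
proof -
  obtain B where B: "orthonormal_basis (h x) B" using C.orthonormal_basis_exists[OF x] by (elim exE)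
  interpret h: inner_form "h x" by (rule C.inner[OF x])
  let ?T = "\<lambda>X Y. (0 :: real, C.A x (snd X) (snd Y) z - q t *\<^sub>R C.P x (fst X *\<^sub>R snd Y + fst Y *\<^sub>R snd X) z)"
  note A_simps = bilinear_ladd[OF C.bilinear_A[OF x]] bilinear_radd[OF C.bilinear_A[OF x]]
    bilinear_lmul[OF C.bilinear_A[OF x]] bilinear_rmul[OF C.bilinear_A[OF x]] bilinear_lzero[OF C.bilinear_A[OF x]]
  have "bilinear ?T"
    unfolding bilinear_def
    by (intro conjI allI linearI) (simp_all add: C.P_simps[OF x] A_simps algebra_simps)
  then have "metric_trace (rmetric W i (t, x)) ?T = (1 / (f t)\<^sup>2) *\<^sub>R (\<Sum>b\<in>B. (0, C.A x b b z))"
    by (simp only: warped_trace[OF x B]) (simp add: C.P_simps[OF x] A_simps zero_prod_def)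
  then show ?thesis
    unfolding rough_laplacian_J_def nablaD2_end_phi[OF x] rough_laplacian_cstr_eq[OF x B]
    using h.orthonormal_finite[OF B] by (simp add: sum_prod)
qed

lemma tau_J_W:
  assumes x: "x \<in> V"
  shows "tau_J W i (t, x) (c, z) = (0, (1 / (f t)\<^sup>2) *\<^sub>R
    (rough_laplacian_cstr M i x (J x z) - J x (rough_laplacian_cstr M i x z)))"
  by (simp add: tau_J_def rough_laplacian_J_W[OF x] C.J_simps[OF x] algebra_simps)

section \<open>Cosymplectic and nearly Kaehler fibres; the harmonicity equations\<close>

lemma eta_W: "x \<in> V \<Longrightarrow> eta W i (t, x) (c, z) = c"
  by (simp add: eta_def bilinear_lzero[OF C.g_bil])

text \<open>The codifferential paired with \<open>w\<close> is minus the inner product of the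
  divergence of \<open>J\<close> with \<open>w\<close>; nondegeneracy of the metric gives the
  claim.\<close>

lemma cosymplectic_sum:
  assumes "cosymplectic M" and x: "x \<in> V" and B: "orthonormal_basis (h x) B"
  shows "(\<Sum>b\<in>B. C.P x b b) = 0"
proof -
  interpret h: inner_form "h x" by (rule C.inner[OF x])
  have bl: "bilinear (\<lambda>u v. h x (C.P x u v) w)" for w
    unfolding bilinear_def by (intro conjI allI linearI) (simp_all add: C.P_simps[OF x] h.form_simps)
  have "kaehler_form M i = (\<lambda>y v w. h y (J y v) w)"
    by (simp add: fun_eq_iff kaehler_form_def)
  then have "codifferential_kaehler_form M i x w = - (\<Sum>b\<in>B. h x (C.P x b b) w)" for w
    unfolding codifferential_kaehler_form_def
    by (simp only: C.nabla_form_kaehler[OF x] h.metric_trace_eq[OF B bl])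
  moreover have "codifferential_kaehler_form M i x w = 0" for w
    using assms(1) i x by (simp add: cosymplectic_def)
  ultimately show ?thesis
    by (intro h.form_eqI) (simp add: h.form_sum_left h.form_simps)
qed

text \<open>The two alternatives annihilate different factors of \<open>T_phi_W\<close>: the
  divergence of \<open>J\<close> in the cosymplectic case, \<open>q\<close> for constant
  \<open>f\<close>.\<close>

lemma T_phi_W_eq_0:
  assumes "cosymplectic M \<or> (\<exists>c. \<forall>t. f t = c)" and x: "x \<in> V"
  shows "T_phi W i (t, x) = 0"
proof -
  obtain B where B: "orthonormal_basis (h x) B" using C.orthonormal_basis_exists[OF x] by (elim exE)
  interpret h: inner_form "h x" by (rule C.inner[OF x])
  show ?thesis
    using assms(1)
  proof
    assume "cosymplectic M"
    then show ?thesis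
      using cosymplectic_sum[OF _ x B] h.orthonormal_finite[OF B] by (simp add: T_phi_W[OF x B] sum_prod zero_prod_def)
  next
    assume "\<exists>c. \<forall>t. f t = c"
    then obtain c where "f = (\<lambda>_. c)" by auto
    then have "q t = 0" unfolding q_def df_def by (simp add: frechet_derivative_const)
    then show ?thesis by (simp add: T_phi_W[OF x B])
  qed
qed

lemma harmonic_at_iff:
  assumes "cosymplectic M \<or> (\<exists>c. \<forall>t. f t = c)" and x: "x \<in> V"
  shows "tau_xi W i (t, x) + (1/2) *\<^sub>R phi W i (t, x) (T_phi W i (t, x)) = 0 \<and>
      (\<forall>z. eta W i (t, x) z = 0 \<longrightarrow> tau_J W i (t, x) z = 0) \<longleftrightarrow>
    (\<forall>z. rough_laplacian_cstr M i x (J x z) - J x (rough_laplacian_cstr M i x z) = 0)"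
proof -
  have "phi W i (t, x) 0 = 0"
    using C.J_simps(5)[OF x] by (simp add: zero_prod_def)
  then have 1: "tau_xi W i (t, x) + (1/2) *\<^sub>R phi W i (t, x) (T_phi W i (t, x)) = 0"
    by (simp add: tau_xi_W[OF x] T_phi_W_eq_0[OF assms])
  \<comment> \<open>The kernel of \<open>eta\<close> consists of the vectors with first component
    \<open>0\<close>, and the positive factor in \<open>tau_J_W\<close> can be divided out.\<close>
  have 2: "tau_J W i (t, x) (0, z) = 0 \<longleftrightarrow>
      rough_laplacian_cstr M i x (J x z) - J x (rough_laplacian_cstr M i x z) = 0" for z
    using f_nz[of t] by (simp add: tau_J_W[OF x] zero_prod_def)
  show ?thesis
    using 1 2 by (auto simp: eta_W[OF x])
qed

lemma nearly_kaehler_rough_laplacian: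
  assumes "nearly_kaehler M" and x: "x \<in> V"
  shows "rough_laplacian_cstr M i x (J x z) - J x (rough_laplacian_cstr M i x z) = 0"
proof -
  interpret nearly_kaehler_chart V h \<Gamma> J
    by standard (use assms(1) i in \<open>auto simp: nearly_kaehler_def\<close>)
  obtain B where B: "orthonormal_basis (h x) B" using C.orthonormal_basis_exists[OF x] by (elim exE)
  show ?thesis
    by (simp add: rough_laplacian_cstr_eq[OF x B] nearly_kaehler_harmonic[OF x B] C.J_simps[OF x])
qed

text \<open>The trace involves only diagonal values of the derivative of \<open>J\<close>, and these
  vanish one by one, whatever basis the trace chooses.\<close>

lemma nearly_kaehler_codifferential:
  assumes "nearly_kaehler M" and x: "x \<in> V"
  shows "codifferential_kaehler_form M i x w = 0"
proof -
  have "C.P x v v = 0" for v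
    using assms i by (simp add: nearly_kaehler_def)
  moreover have "kaehler_form M i = (\<lambda>y v w. h y (J y v) w)"
    by (simp add: fun_eq_iff kaehler_form_def)
  ultimately show ?thesis
    unfolding codifferential_kaehler_form_def metric_trace_def
    by (simp add: C.nabla_form_kaehler[OF x] bilinear_lzero[OF C.g_bil[OF x]])
qed

end

theorem theorem3p3:
  fixes M :: "('i, 'a, 'e::euclidean_space) almost_hermitian"
    and f :: "real \<Rightarrow> real"
    and n :: nat
  assumes "almost_hermitian_manifold M"
    and "DIM('e) = 2 * n"
    and "smooth_on UNIV f"
    and "\<forall>t. f t > 0"
  shows "(cosymplectic M \<or> (\<exists>c. \<forall>t. f t = c) \<longrightarrow>
            (harmonic_almost_contact (warped_product f M) \<longleftrightarrow> harmonic_almost_hermitian M)) \<and>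
         (nearly_kaehler M \<longrightarrow> harmonic_almost_contact (warped_product f M))"
proof -
  have chart: "warped_chart M f i" if "i \<in> charts M" for i
    using assms that by unfold_locales auto
  have iff: "harmonic_almost_contact (warped_product f M) \<longleftrightarrow> harmonic_almost_hermitian M"
    if c: "cosymplectic M \<or> (\<exists>c. \<forall>t. f t = c)"
  proof -
    have "harmonic_almost_contact (warped_product f M) \<longleftrightarrow>
      (\<forall>i\<in>charts M. \<forall>x\<in>cimg M i. \<forall>t :: real. \<forall>z.
        rough_laplacian_cstr M i x (cstr M i x z) - cstr M i x (rough_laplacian_cstr M i x z) = 0)"
      unfolding harmonic_almost_contact_def
      using warped_chart.harmonic_at_iff[OF chart c] by fastforce
    then show ?thesis by (simp add: harmonic_almost_hermitian_def)
  qed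
  have "harmonic_almost_contact (warped_product f M)" if nk: "nearly_kaehler M"
  proof -
    \<comment> \<open>This places a nearly Kaehler fibre under the equivalence for every
      \<open>f\<close>; it remains to see that the fibre is harmonic.\<close>
    have "cosymplectic M"
      unfolding cosymplectic_def using warped_chart.nearly_kaehler_codifferential[OF chart nk] by blast
    moreover have "harmonic_almost_hermitian M"
      unfolding harmonic_almost_hermitian_def using warped_chart.nearly_kaehler_rough_laplacian[OF chart nk] by blast
    ultimately show ?thesis using iff by blast
  qed
  then show ?thesis using iff by blast
qed

end
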